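(* Let $k\geq1$ be an integer and let $G$ be a connected graph of order $n\geq 3(k+2)\delta+2$ with minimum degree $\delta$. If $\rho(G)\geq\rho(K_{\delta}\vee(K_{n-k\delta-2\delta}+I_{k\delta+\delta}))$, then $G$ has a spanning tree with leaf degree at most $k$ unless $G\cong K_{\delta}\vee(K_{n-k\delta-2\delta}+I_{k\delta+\delta})$.
   Context: All graphs are finite and simple. $\rho(G)$ is the spectral radius of the adjacency matrix of $G$. For a spanning tree $T$ of $G$, the leaf degree of a vertex $v$ of $T$ is the number of leaves of $T$ adjacent to $v$ in $T$, and the leaf degree of $T$ is the maximum leaf degree over all vertices of $T$. $K_n$ is the complete graph and $I_n$ the edgeless graph on $n$ vertices; $G_1+G_2$ denotes disjoint union and $G_1\vee G_2$ the join. *)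

theory Defs
  imports Complex_Main
begin

definition simple_graph :: "'a set \<Rightarrow> 'a set set \<Rightarrow> bool" where
  "simple_graph V E \<longleftrightarrow> finite V \<and> (\<forall>e\<in>E. \<exists>u v. e = {u, v} \<and> u \<noteq> v \<and> u \<in> V \<and> v \<in> V)"

definition adj :: "'a set set \<Rightarrow> 'a \<Rightarrow> 'a \<Rightarrow> bool" where
  "adj E u v \<longleftrightarrow> {u, v} \<in> E"

definition degree :: "'a set \<Rightarrow> 'a set set \<Rightarrow> 'a \<Rightarrow> nat" where
  "degree V E v = card {u \<in> V. adj E v u}"

definition min_degree :: "'a set \<Rightarrow> 'a set set \<Rightarrow> nat" where
  "min_degree V E = Min (degree V E ` V)"

definition walk :: "'a set \<Rightarrow> 'a set set \<Rightarrow> 'a list \<Rightarrow> bool" where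
  "walk V E p \<longleftrightarrow> p \<noteq> [] \<and> set p \<subseteq> V \<and> (\<forall>i. Suc i < length p \<longrightarrow> adj E (p ! i) (p ! Suc i))"

definition connected_graph :: "'a set \<Rightarrow> 'a set set \<Rightarrow> bool" where
  "connected_graph V E \<longleftrightarrow> V \<noteq> {} \<and>
     (\<forall>u\<in>V. \<forall>v\<in>V. \<exists>p. walk V E p \<and> hd p = u \<and> last p = v)"

definition has_cycle :: "'a set \<Rightarrow> 'a set set \<Rightarrow> bool" where
  "has_cycle V E \<longleftrightarrow> (\<exists>p. walk V E p \<and> distinct p \<and> length p \<ge> 3 \<and> adj E (last p) (hd p))"

definition is_tree :: "'a set \<Rightarrow> 'a set set \<Rightarrow> bool" where
  "is_tree V E \<longleftrightarrow> simple_graph V E \<and> connected_graph V E \<and> \<not> has_cycle V E"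

definition spanning_tree :: "'a set \<Rightarrow> 'a set set \<Rightarrow> 'a set set \<Rightarrow> bool" where
  "spanning_tree V E T \<longleftrightarrow> T \<subseteq> E \<and> is_tree V T"

definition is_leaf :: "'a set \<Rightarrow> 'a set set \<Rightarrow> 'a \<Rightarrow> bool" where
  "is_leaf V T v \<longleftrightarrow> v \<in> V \<and> degree V T v = 1"

definition vertex_leaf_degree :: "'a set \<Rightarrow> 'a set set \<Rightarrow> 'a \<Rightarrow> nat" where
  "vertex_leaf_degree V T v = card {u \<in> V. adj T v u \<and> is_leaf V T u}"

definition leaf_degree :: "'a set \<Rightarrow> 'a set set \<Rightarrow> nat" where
  "leaf_degree V T = Max (vertex_leaf_degree V T ` V)"

definition adj_eigenvalue :: "'a set \<Rightarrow> 'a set set \<Rightarrow> complex \<Rightarrow> bool" where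
  "adj_eigenvalue V E \<mu> \<longleftrightarrow> (\<exists>x :: 'a \<Rightarrow> complex. (\<exists>v\<in>V. x v \<noteq> 0) \<and>
      (\<forall>u\<in>V. (\<Sum>w\<in>V. (if adj E u w then 1 else 0) * x w) = \<mu> * x u))"

definition spectral_radius :: "'a set \<Rightarrow> 'a set set \<Rightarrow> real" where
  "spectral_radius V E = Max {cmod \<mu> | \<mu>. adj_eigenvalue V E \<mu>}"

definition graph_iso :: "'a set \<Rightarrow> 'a set set \<Rightarrow> 'b set \<Rightarrow> 'b set set \<Rightarrow> bool" where
  "graph_iso V E V' E' \<longleftrightarrow> (\<exists>f. bij_betw f V V' \<and>
      (\<forall>u\<in>V. \<forall>v\<in>V. adj E u v \<longleftrightarrow> adj E' (f u) (f v)))"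

text \<open>The graph K_a \<or> (K_b + I_c) on vertex set {0..<a+b+c}: A = {0..<a} induces K_a and is
  joined to everything, B = {a..<a+b} induces K_b, C = {a+b..<a+b+c} is independent.\<close>
definition join_K_union_K_I_verts :: "nat \<Rightarrow> nat \<Rightarrow> nat \<Rightarrow> nat set" where
  "join_K_union_K_I_verts a b c = {0..<a+b+c}"

definition join_K_union_K_I_edges :: "nat \<Rightarrow> nat \<Rightarrow> nat \<Rightarrow> nat set set" where
  "join_K_union_K_I_edges a b c =
     {{u, v} | u v. u \<in> {0..<a+b+c} \<and> v \<in> {0..<a+b+c} \<and> u \<noteq> v \<and>
        (u < a \<or> v < a \<or> (u \<in> {a..<a+b} \<and> v \<in> {a..<a+b}))}"

end

theory Submission
  imports Defs "Jordan_Normal_Form.Char_Poly"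
begin

text \<open>
  The combinatorial input is Kaneko's theorem for connected graphs of order at least four: if
  $i(G - S) < (k + 1) |S|$ for every nonempty $S$,
  then $G$ has a spanning tree of leaf degree at most $k$. Among the connected spanning subgraphs
  satisfying this condition take an edge-minimal one. Each edge of a cycle in it is blocked by a
  set for which the condition is tight (or almost tight), and uncrossing such sets along the cycle
  leads to a contradiction. So the minimal subgraph is a tree, and $S = \{v\}$ bounds
  its leaf degree.

  If $G$ has no such tree, some $S$ of size $s \ge \delta$ isolates at least $(k + 1) s$
  vertices, so $G$ lies in $K_s \vee (K_{n-(k+2)s} + I_{(k+1)s})$. Let $r$ be a large root
  of the characteristic polynomial of the quotient matrix for $s = \delta$. The weight vector
  constant on the three parts is a positive supersolution $A x \le r x$ on $G$, strict on $S$
  unless $s = \delta$. As $\rho(G) \ge r$, it must be an exact eigenvector, which forces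
  $s = \delta$ and every edge of the extremal graph.
\<close>

section \<open>Kaneko's theorem\<close>

text \<open>The combinatorial contradictions are counts of \<open>slack\<close>, which is -1 at the
  empty set and nonnegative elsewhere. Uncrossing two blocking sets pushes the slacks of a trimmed
  union and of the intersection below what this permits, or forces equality and an explicit small
  configuration. "Almost tight" sets arise because deleting an edge may isolate both of its ends at
  once; they must be excluded on a cycle before the tight ones are treated. In the spectral half,
  the polynomials for s and for \<delta> are compared at the same point r. Their difference has the
  factor s - \<delta>, so largest roots for different s never have to be compared. The order bound
  gives (k + 2) \<delta> < n / 3 and hence r > 2 n / 3, while (k + 2) s \<le> n; this makes the
  cofactor positive. Perron-Frobenius theory is replaced by pairing the supersolution with the
  moduli of a complex eigenvector.\<close>

definition nbs :: "'a set \<Rightarrow> 'a set set \<Rightarrow> 'a \<Rightarrow> 'a set" where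
  "nbs V E v = {u \<in> V. adj E v u}"

definition isolated :: "'a set \<Rightarrow> 'a set set \<Rightarrow> 'a set \<Rightarrow> 'a set" where
  "isolated V E S = {v \<in> V - S. nbs V E v \<subseteq> S}"

text \<open>Connectivity through closed vertex sets: deleting an edge, or showing that an
  eigenvector has no zeros, then requires no handling of walks.\<close>

definition nbs_closed_conn :: "'a set \<Rightarrow> 'a set set \<Rightarrow> bool" where
  "nbs_closed_conn V E \<longleftrightarrow> V \<noteq> {} \<and>
     (\<forall>W. W \<subseteq> V \<longrightarrow> W \<noteq> {} \<longrightarrow> (\<forall>v\<in>W. nbs V E v \<subseteq> W) \<longrightarrow> W = V)"

lemma simple_graph_adjD:
  assumes "simple_graph V E" "adj E u v"
  shows "u \<in> V" "v \<in> V" "u \<noteq> v"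
proof -
  from assms obtain a b where "{u, v} = {a, b}" "a \<noteq> b" "a \<in> V" "b \<in> V"
    unfolding simple_graph_def adj_def by blast
  then show "u \<in> V" "v \<in> V" "u \<noteq> v" by (auto simp: doubleton_eq_iff)
qed

lemma adj_sym: "adj E u v \<longleftrightarrow> adj E v u"
  by (simp add: adj_def insert_commute)

lemma connected_graph_iff_nbs_closed_conn:
  "connected_graph V E \<longleftrightarrow> nbs_closed_conn V E"
proof
  assume c: "connected_graph V E"
  show "nbs_closed_conn V E"
    unfolding nbs_closed_conn_def
  proof (intro conjI allI impI)
    show "V \<noteq> {}" using c by (simp add: connected_graph_def)
    fix W assume W: "W \<subseteq> V" "W \<noteq> {}" "\<forall>v\<in>W. nbs V E v \<subseteq> W"
    then obtain u where u: "u \<in> W" by blast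
    have "v \<in> W" if v: "v \<in> V" for v
    proof -
      obtain p where p: "walk V E p" "hd p = u" "last p = v"
        using c u v W(1) unfolding connected_graph_def by blast
      have "i < length p \<Longrightarrow> p ! i \<in> W" for i
      proof (induction i)
        case 0
        then show ?case using p u by (simp add: hd_conv_nth walk_def)
      next
        case (Suc i)
        then have "p ! i \<in> W" by simp
        moreover have "p ! Suc i \<in> nbs V E (p ! i)"
          using p(1) Suc.prems nth_mem[of "Suc i" p] unfolding walk_def nbs_def by auto
        ultimately show ?case using W(3) by blast
      qed
      moreover have "p \<noteq> []" using p(1) by (simp add: walk_def)
      ultimately have "last p \<in> W" by (simp add: last_conv_nth)
      then show ?thesis using p(3) by simp
    qed
    then have "V \<subseteq> W" by (rule subsetI)
    with W(1) show "W = V" by (rule subset_antisym)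
  qed
next
  assume c: "nbs_closed_conn V E"
  show "connected_graph V E"
    unfolding connected_graph_def
  proof (intro conjI ballI)
    show "V \<noteq> {}" using c by (simp add: nbs_closed_conn_def)
    fix u v assume u: "u \<in> V" and v: "v \<in> V"
    define W where "W = {w. \<exists>p. walk V E p \<and> hd p = u \<and> last p = w}"
    have "walk V E [u]" using u by (simp add: walk_def)
    then have uW: "u \<in> W" unfolding W_def by force
    have WV: "W \<subseteq> V" unfolding W_def walk_def using last_in_set by blast
    have "\<forall>w\<in>W. nbs V E w \<subseteq> W"
    proof (intro ballI subsetI)
      fix w z assume "w \<in> W" and z: "z \<in> nbs V E w"
      then obtain p where p: "walk V E p" "hd p = u" "last p = w" unfolding W_def by blast
      have "walk V E (p @ [z])"
        unfolding walk_def
      proof (intro conjI allI impI)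
        show "p @ [z] \<noteq> []" by simp
        show "set (p @ [z]) \<subseteq> V" using p z by (auto simp: walk_def nbs_def)
        fix i assume i: "Suc i < length (p @ [z])"
        show "adj E ((p @ [z]) ! i) ((p @ [z]) ! Suc i)"
        proof (cases "Suc i < length p")
          case True
          then show ?thesis using p by (simp add: walk_def nth_append)
        next
          case False
          then have "i = length p - 1" "p \<noteq> []" using i p by (auto simp: walk_def)
          then show ?thesis using p z False
            by (auto simp: nth_append nbs_def last_conv_nth)
        qed
      qed
      moreover have "hd (p @ [z]) = u" "last (p @ [z]) = z"
        using p by (auto simp: walk_def)
      ultimately show "z \<in> W" unfolding W_def by blast
    qed
    then have "W = V" using c uW WV unfolding nbs_closed_conn_def by blast
    then show "\<exists>p. walk V E p \<and> hd p = u \<and> last p = v" using v unfolding W_def by blast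
  qed
qed

section \<open>Slack of vertex sets and uncrossing\<close>

locale leaf_bound_graph =
  fixes V :: "'a set" and E :: "'a set set" and k :: nat
  assumes simple: "simple_graph V E"
    and k_pos: "k \<ge> 1"
begin

abbreviation N where "N \<equiv> nbs V E"
abbreviation iso where "iso \<equiv> isolated V E"

text \<open>Kaneko's condition for \<open>S\<close> says that this integer is nonnegative. The shift
  by one turns the strict inequality into that form and, in a graph without isolated vertices, gives
  the empty set the value -1.\<close>

definition slack :: "'a set \<Rightarrow> int" where
  "slack S = (int k + 1) * int (card S) - 1 - int (card (iso S))"

lemma finite_V: "finite V"
  using simple by (simp add: simple_graph_def)

lemma finite_iso: "finite (iso S)"
  using finite_V by (simp add: isolated_def)

lemma N_sym: "u \<in> N v \<longleftrightarrow> v \<in> N u"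
  using simple_graph_adjD[OF simple] adj_sym unfolding nbs_def by fastforce

lemma N_irrefl: "v \<notin> N v"
  using simple_graph_adjD[OF simple] unfolding nbs_def by blast

lemma N_sub: "N v \<subseteq> V" by (auto simp: nbs_def)

lemma isoD: "v \<in> iso S \<Longrightarrow> v \<in> V" "v \<in> iso S \<Longrightarrow> v \<notin> S" "v \<in> iso S \<Longrightarrow> N v \<subseteq> S"
  by (auto simp: isolated_def)

lemma isoI: "v \<in> V \<Longrightarrow> v \<notin> S \<Longrightarrow> N v \<subseteq> S \<Longrightarrow> v \<in> iso S"
  by (auto simp: isolated_def)

text \<open>
  Isolated vertices are not supermodular on the nose: a vertex isolated by one set may belong to
  the other. Removing these vertices (\<open>X\<close>, \<open>X'\<close>) from the union repairs this and even gains;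
  \<open>D\<close> is a further part of the union that can be discarded for free, and \<open>G\<close> consists of vertices
  isolated only by the union.
\<close>

lemma slack_uncross:
  assumes S: "S \<subseteq> V" and S': "S' \<subseteq> V"
    and X: "X = iso S \<inter> S'" and X': "X' = iso S' \<inter> S"
    and U: "U = (S \<union> S') - X - X' - D"
    and D: "D \<subseteq> (S \<union> S') - X - X' - S \<inter> S'"
    and Dn: "\<And>v d. d \<in> D \<Longrightarrow> v \<in> (iso S - X) \<union> (iso S' - X') \<Longrightarrow> d \<notin> N v"
    and G: "G \<subseteq> iso U" "G \<inter> (iso S \<union> iso S') = {}"
  shows "slack U + slack (S \<inter> S') \<le> slack S + slack S'
           - int k * (int (card X) + int (card X')) - (int k + 1) * int (card D) - int (card G)"
proof -
  have fin: "finite S" "finite S'" "finite X" "finite X'" "finite D" "finite G"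
    using finite_subset[OF S finite_V] finite_subset[OF S' finite_V] X X' D
      finite_subset[OF G(1) finite_iso] by (auto intro: finite_subset)
  have dXX': "X \<inter> X' = {}" using X X' isoD by blast
  have sub: "X \<subseteq> S \<union> S'" "X' \<subseteq> S \<union> S'" "D \<subseteq> S \<union> S'" using X X' D by auto
  have cU: "int (card U) + int (card (S \<inter> S')) =
     int (card S) + int (card S') - int (card X) - int (card X') - int (card D)"
  proof -
    have "card (X \<union> X' \<union> D) = card X + card X' + card D"
      using fin dXX' D by (subst card_Un_disjoint; auto simp: card_Un_disjoint)+
    moreover have "U = (S \<union> S') - (X \<union> X' \<union> D)" using U by blast
    moreover have "card ((S \<union> S') - (X \<union> X' \<union> D)) = card (S \<union> S') - card (X \<union> X' \<union> D)"
      using fin sub by (intro card_Diff_subset) auto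
    moreover have "card (X \<union> X' \<union> D) \<le> card (S \<union> S')"
      using fin sub by (intro card_mono) auto
    moreover have "card S + card S' = card (S \<union> S') + card (S \<inter> S')"
      using fin by (intro card_Un_Int)
    ultimately show ?thesis by simp
  qed
  have s1: "iso S - X \<subseteq> iso U"
  proof
    fix v assume v: "v \<in> iso S - X"
    have vV: "v \<in> V" "v \<notin> U" using v isoD[of v S] unfolding U X by auto
    \<comment> \<open>A neighbour \<open>u\<close> removed as a member of \<open>X'\<close> would
      force \<open>v\<close> into \<open>S'\<close>, hence into \<open>X\<close>.\<close>
    have "u \<in> U" if u: "u \<in> N v" for u
    proof -
      have "u \<notin> D" using Dn[of u v] v u by blast
      moreover have "u \<in> S" using v u isoD(3)[of v S] by blast
      moreover have "v \<in> N u" using u N_sym by blast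
      ultimately show ?thesis
        using v isoD(2,3)[of u S] isoD(3)[of u "S'"] unfolding U X X' by blast
    qed
    then show "v \<in> iso U" using vV by (intro isoI) auto
  qed
  have s2: "iso S' - X' \<subseteq> iso U"
  proof
    fix v assume v: "v \<in> iso S' - X'"
    have vV: "v \<in> V" "v \<notin> U" using v isoD[of v S'] unfolding U X' by auto
    have "u \<in> U" if u: "u \<in> N v" for u
    proof -
      have "u \<notin> D" using Dn[of u v] v u by blast
      moreover have "u \<in> S'" using v u isoD(3)[of v S'] by blast
      moreover have "v \<in> N u" using u N_sym by blast
      ultimately show ?thesis
        using v isoD(2,3)[of u S'] isoD(3)[of u "S"] unfolding U X X' by blast
    qed
    then show "v \<in> iso U" using vV by (intro isoI) auto
  qed
  have s3: "(iso S - X) \<inter> (iso S' - X') \<subseteq> iso (S \<inter> S')"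
    unfolding isolated_def by blast
  let ?A = "iso S - X" and ?B = "iso S' - X'"
  have "card (?A \<union> ?B \<union> G) \<le> card (iso U)"
    using s1 s2 G finite_iso by (intro card_mono) auto
  moreover have "card (?A \<union> ?B \<union> G) = card (?A \<union> ?B) + card G"
    using G fin finite_iso by (intro card_Un_disjoint) auto
  moreover have "card ?A + card ?B = card (?A \<union> ?B) + card (?A \<inter> ?B)"
    using finite_iso by (intro card_Un_Int) auto
  moreover have "card (?A \<inter> ?B) \<le> card (iso (S \<inter> S'))"
    using s3 finite_iso by (intro card_mono) auto
  moreover have "card ?A + card X = card (iso S)"
    using card_Int_Diff[OF finite_iso, of S S'] X by (simp add: Diff_Int2 Diff_Int)
  moreover have "card ?B + card X' = card (iso S')"
    using card_Int_Diff[OF finite_iso, of S' S] X' by (simp add: Diff_Int2 Diff_Int)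
  ultimately have cI: "int (card (iso S)) + int (card (iso S')) - int (card X) - int (card X') + int (card G)
      \<le> int (card (iso U)) + int (card (iso (S \<inter> S')))" by linarith
  have "slack U + slack (S \<inter> S') = (int k + 1) * (int (card U) + int (card (S \<inter> S'))) - 2
     - (int (card (iso U)) + int (card (iso (S \<inter> S'))))"
    unfolding slack_def by (simp add: algebra_simps)
  also have "\<dots> \<le> (int k + 1) * (int (card S) + int (card S') - int (card X) - int (card X') - int (card D)) - 2
     - (int (card (iso S)) + int (card (iso S')) - int (card X) - int (card X') + int (card G))"
    unfolding cU using cI by linarith
  also have "\<dots> = slack S + slack S'
           - int k * (int (card X) + int (card X')) - (int k + 1) * int (card D) - int (card G)"
    unfolding slack_def by (simp add: algebra_simps)
  finally show ?thesis .
qed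

end

section \<open>Blocking sets in graphs satisfying Kaneko's condition\<close>

locale kaneko_graph = leaf_bound_graph +
  assumes conn: "nbs_closed_conn V E"
    and card_V: "card V \<ge> 4"
    and slack_nonneg: "\<And>S. S \<subseteq> V \<Longrightarrow> S \<noteq> {} \<Longrightarrow> slack S \<ge> 0"
begin

lemma iso_empty: "iso {} = {}"
proof (rule ccontr)
  assume "iso {} \<noteq> {}"
  then obtain v where v: "v \<in> V" "N v = {}" unfolding isolated_def by blast
  then have "{v} = V" using conn unfolding nbs_closed_conn_def by blast
  then have "card V = 1" using card.empty by (metis is_singletonI is_singleton_altdef)
  then show False using card_V by simp
qed

lemma slack_empty: "slack {} = -1"
  by (simp add: slack_def iso_empty)

lemma slack_ge: "S \<subseteq> V \<Longrightarrow> slack S \<ge> -1"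
  using slack_nonneg[of S] slack_empty by (cases "S = {}") auto

lemma slack_neg_empty: "S \<subseteq> V \<Longrightarrow> slack S < 0 \<Longrightarrow> S = {}"
  using slack_nonneg by (meson not_le)

text \<open>Dropping \<open>p\<close> from \<open>S\<close> lowers the main term by k + 1 and loses
  only isolated vertices adjacent to \<open>p\<close>. The slack of the smaller set is at least -1,
  and at least 0 if that set is nonempty; this accounts for the two bounds.\<close>

lemma card_iso_nbs:
  assumes S: "S \<subseteq> V" and p: "p \<in> S"
  shows "int (card (N p \<inter> iso S)) \<ge> int k - slack S"
    and "S \<noteq> {p} \<Longrightarrow> int (card (N p \<inter> iso S)) \<ge> int k + 1 - slack S"
proof -
  have "iso S - N p \<subseteq> iso (S - {p})"
  proof
    fix v assume "v \<in> iso S - N p"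
    then show "v \<in> iso (S - {p})" using N_sym[of v p] isoD[of v S] by (intro isoI) auto
  qed
  then have "card (iso S - N p) \<le> card (iso (S - {p}))" by (intro card_mono finite_iso)
  moreover have "card (iso S - N p) + card (N p \<inter> iso S) = card (iso S)"
    by (metis Int_commute add.commute card_Int_Diff finite_iso)
  moreover have "card S = card (S - {p}) + 1"
    using S p finite_V by (metis Suc_eq_plus1 card.remove finite_subset)
  ultimately have *: "int (card (N p \<inter> iso S)) \<ge> int k + 1 - slack S + slack (S - {p})"
    unfolding slack_def by (simp add: algebra_simps)
  show "int (card (N p \<inter> iso S)) \<ge> int k - slack S"
    using * slack_ge[of "S - {p}"] S by fastforce
  show "int (card (N p \<inter> iso S)) \<ge> int k + 1 - slack S" if "S \<noteq> {p}"
    using * slack_nonneg[of "S - {p}"] S p that by fastforce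
qed

text \<open>At least k neighbours of \<open>p\<close> are isolated by \<open>Z\<close>, and all of
  them lie in \<open>S'\<close>, since \<open>q\<close> is not among them. Uncrossing may also
  discard \<open>p\<close>, so the two slacks sum to at most -1 - (k + 1), below the possible
  minimum -2.\<close>

lemma tight_vertex_not_blocked:
  assumes "Z \<subseteq> V" "S' \<subseteq> V" "slack Z = 0" "slack S' = 0"
    and p: "p \<in> Z" "p \<notin> S'" and q: "N p - S' = {q}" "q \<notin> iso Z"
  shows False
proof -
  let ?X = "iso Z \<inter> S'" and ?X' = "iso S' \<inter> Z"
  have qD: "z \<in> S' \<or> z = q" if "z \<in> N p" for z using q(1) that by blast
  have "N p \<inter> iso Z \<subseteq> ?X" using q(2) qD by blast
  then have "card (N p \<inter> iso Z) \<le> card ?X" by (intro card_mono) (auto simp: finite_iso)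
  then have "int (card ?X) \<ge> int k" using card_iso_nbs(1)[of Z p] assms by linarith
  then have Xk: "int k * int (card ?X) \<ge> 1"
    using k_pos by (smt (verit) mult_le_cancel_left1 of_nat_1 of_nat_mono)
  define U where "U = (Z \<union> S') - ?X - ?X' - {p}"
  have "p \<notin> iso S'" using q isoD(3) by blast
  then have "slack U + slack (Z \<inter> S') \<le> slack Z + slack S'
      - int k * (int (card ?X) + int (card ?X')) - (int k + 1) * int (card {p}) - int (card ({}::'a set))"
  proof (intro slack_uncross[where D = "{p}" and G = "{}"])
    show "{p} \<subseteq> Z \<union> S' - ?X - ?X' - Z \<inter> S'"
      using p \<open>p \<notin> iso S'\<close> isoD(2)[of p Z] by blast
    show "d \<notin> N v" if "d \<in> {p}" "v \<in> iso Z - ?X \<union> (iso S' - ?X')" for v d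
      using that q(2) qD[of v] p isoD(3)[of v S'] N_sym[of p v] by auto
  qed (use assms U_def in auto)
  then have "slack U + slack (Z \<inter> S') \<le> - 1 - (int k + 1)"
    using assms Xk by (simp add: algebra_simps) (smt (verit) mult_nonneg_nonneg of_nat_0_le_iff)
  moreover have "slack U \<ge> -1" "slack (Z \<inter> S') \<ge> -1"
    using assms(1,2) U_def by (auto intro!: slack_ge)
  ultimately show False using k_pos by linarith
qed

text \<open>
  \<open>blk S a b\<close> is the tight certificate showing that deleting the edge \<open>ab\<close> destroys the condition
  because it isolates \<open>a\<close>. \<open>semi_blk S a b\<close> is the only other obstruction: \<open>ab\<close> is a component
  of $G - S$, and its deletion isolates two vertices at once.
\<close>

definition blk :: "'a set \<Rightarrow> 'a \<Rightarrow> 'a \<Rightarrow> bool" where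
  "blk S a b \<longleftrightarrow> S \<subseteq> V \<and> slack S = 0 \<and> a \<in> V \<and> a \<notin> S \<and> N a - S = {b}"

definition semi_blk :: "'a set \<Rightarrow> 'a \<Rightarrow> 'a \<Rightarrow> bool" where
  "semi_blk S a b \<longleftrightarrow> S \<subseteq> V \<and> slack S = 1 \<and> N a - S = {b} \<and> N b - S = {a}"

lemma blkD:
  assumes "blk S a b"
  shows "S \<subseteq> V" "slack S = 0" "a \<in> V" "a \<notin> S" "b \<notin> S" "b \<in> N a" "N a - S = {b}"
    "\<And>z. z \<in> N a \<Longrightarrow> z \<in> S \<or> z = b" "a \<notin> iso S" "b \<notin> iso S" "S \<noteq> {}"
proof -
  show *: "S \<subseteq> V" "slack S = 0" "a \<in> V" "a \<notin> S" "N a - S = {b}"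
    using assms unfolding blk_def by auto
  then show "b \<notin> S" "b \<in> N a" "\<And>z. z \<in> N a \<Longrightarrow> z \<in> S \<or> z = b" by blast+
  then show "a \<notin> iso S" "b \<notin> iso S"
    using isoD(3)[of a S] isoD(3)[of b S] N_sym[of a b] * by blast+
  show "S \<noteq> {}" using * slack_empty by auto
qed

lemma semi_blkD:
  assumes "semi_blk S a b"
  shows "S \<subseteq> V" "slack S = 1" "a \<notin> S" "b \<notin> S" "b \<in> N a" "a \<in> N b"
    "\<And>z. z \<in> N a \<Longrightarrow> z \<in> S \<or> z = b" "\<And>z. z \<in> N b \<Longrightarrow> z \<in> S \<or> z = a"
    "a \<notin> iso S" "b \<notin> iso S" "S \<noteq> {}"
proof -
  have *: "S \<subseteq> V" "slack S = 1" "N a - S = {b}" "N b - S = {a}"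
    using assms unfolding semi_blk_def by auto
  then show "S \<subseteq> V" "slack S = 1" by simp_all
  show **: "a \<notin> S" "b \<notin> S" "b \<in> N a" "a \<in> N b"
    "\<And>z. z \<in> N a \<Longrightarrow> z \<in> S \<or> z = b" "\<And>z. z \<in> N b \<Longrightarrow> z \<in> S \<or> z = a" using * by blast+
  then show "a \<notin> iso S" "b \<notin> iso S"
    using isoD(3)[of a S] isoD(3)[of b S] by blast+
  show "S \<noteq> {}" using * slack_empty by auto
qed

text \<open>Now \<open>b\<close> lies in \<open>S'\<close>, and its neighbours isolated by
  \<open>S'\<close> lie in \<open>S\<close>, so at least k vertices are trimmed and \<open>b\<close>
  is discarded as well. The slacks sum to at most -2k, but \<open>x\<close> survives in the union,
  which allows no less than -1.\<close>

lemma not_semi_blk_and_blk: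
  assumes S: "semi_blk S a b" and S': "blk S' a x" and x: "x \<noteq> b"
  shows False
proof -
  note s = semi_blkD[OF S] and s' = blkD[OF S']
  let ?X = "iso S \<inter> S'" and ?X' = "iso S' \<inter> S"
  have bS': "b \<in> S'" using s'(8)[OF s(5)] x by blast
  have xS: "x \<in> S" using s(7)[OF s'(6)] x by blast
  have "N b \<inter> iso S' \<subseteq> ?X'" using s(8) s'(9) by blast
  then have "card (N b \<inter> iso S') \<le> card ?X'" by (intro card_mono) (auto simp: finite_iso)
  then have X'k: "int (card ?X') \<ge> int k"
    using card_iso_nbs(1)[OF s'(1) bS'] s'(2) by linarith
  then have "int k * (int (card ?X) + int (card ?X')) \<ge> int k * 1"
    using k_pos by (intro mult_left_mono) auto
  moreover define U where "U = (S \<union> S') - ?X - ?X' - {b}"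
  have "slack U + slack (S \<inter> S') \<le> slack S + slack S'
      - int k * (int (card ?X) + int (card ?X')) - (int k + 1) * int (card {b}) - int (card ({}::'a set))"
  proof (intro slack_uncross[where D = "{b}" and G = "{}"])
    show "{b} \<subseteq> S \<union> S' - ?X - ?X' - S \<inter> S'"
      using bS' s(4,10) by blast
    show "d \<notin> N v" if "d \<in> {b}" "v \<in> iso S - ?X \<union> (iso S' - ?X')" for v d
      using that s(4,8) s'(9) isoD(3)[of v S] N_sym[of b v] by blast
  qed (use s s' U_def in auto)
  ultimately have "slack U + slack (S \<inter> S') \<le> 1 - int k - (int k + 1)"
    unfolding s(2) s'(2) by simp
  moreover have "x \<in> U"
    using xS s'(5,10) x isoD(2)[of x S] unfolding U_def by blast
  then have "slack U \<ge> 0" using s(1) s'(1) unfolding U_def by (intro slack_nonneg) auto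
  moreover have "slack (S \<inter> S') \<ge> -1" using s(1) by (intro slack_ge) auto
  ultimately show False using k_pos by linarith
qed

text \<open>Discarding \<open>x\<close> only brings the sum down to -2, so the equality case has to
  be refuted by hand. The second neighbour \<open>y\<close> of \<open>b\<close> is there for the
  case \<open>S = {x}\<close>.\<close>

lemma not_semi_blk_and_blk_opposite:
  assumes S: "semi_blk S a b" and S': "blk S' x a" and x: "x \<noteq> b"
    and y: "y \<in> N b" "y \<noteq> a"
  shows False
proof -
  note s = semi_blkD[OF S] and s' = blkD[OF S']
  let ?X = "iso S \<inter> S'" and ?X' = "iso S' \<inter> S"
  have xN: "x \<in> N a" using s'(6) N_sym by blast
  then have xS: "x \<in> S" using s(7) x by blast
  show False
  proof (cases "S = {x}")
    case True
    then have "y = x" using s(8) y by blast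
    then have "b \<in> N x" using y N_sym by blast
    then have bS': "b \<in> S'" using s'(8)[of b] s(5) N_irrefl by blast
    have "N b \<inter> iso S' = {}" using s(8) True s'(9,10) by blast
    then show False using card_iso_nbs(1)[OF s'(1) bS'] s'(2) k_pos by simp
  next
    case False
    have sub: "N x \<inter> iso S \<subseteq> ?X" using s'(8) s(9) by blast
    then have "card (N x \<inter> iso S) \<le> card ?X" by (intro card_mono) (auto simp: finite_iso)
    then have Xk: "int (card ?X) \<ge> 1"
      using card_iso_nbs(2)[OF s(1) xS False] s(2) k_pos by linarith
    define U where "U = (S \<union> S') - ?X - ?X' - {x}"
    have le: "slack U + slack (S \<inter> S') \<le> slack S + slack S'
        - int k * (int (card ?X) + int (card ?X')) - (int k + 1) * int (card {x}) - int (card ({}::'a set))"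
    proof (intro slack_uncross[where D = "{x}" and G = "{}"])
      show "{x} \<subseteq> S \<union> S' - ?X - ?X' - S \<inter> S'"
        using xS s'(4,9) by blast
      show "d \<notin> N v" if "d \<in> {x}" "v \<in> iso S - ?X \<union> (iso S' - ?X')" for v d
        using that s(9) s'(4,8) isoD(3)[of v S'] N_sym[of x v] by blast
    qed (use s s' U_def in auto)
    have ge: "slack U \<ge> -1" "slack (S \<inter> S') \<ge> -1"
      using s(1) s'(1) unfolding U_def by (auto intro!: slack_ge)
    have "int 1 * (int (card ?X) + int (card ?X') + 1) \<le> int k * (int (card ?X) + int (card ?X') + 1)"
      using k_pos by (intro mult_right_mono) auto
    then have "slack U + slack (S \<inter> S') \<le> - (int (card ?X) + int (card ?X') + 1)"
      using le s(2) s'(2) by (simp add: algebra_simps)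
    then have "card ?X' = 0" "slack U < 0" "slack (S \<inter> S') < 0" using Xk ge by linarith+
    then have e: "?X' = {}" "U = {}" "S \<inter> S' = {}"
      using slack_neg_empty[of U] slack_neg_empty[of "S \<inter> S'"] s(1) s'(1) finite_iso
      unfolding U_def by auto
    \<comment> \<open>In the equality case every vertex of \<open>S'\<close> is isolated by
      \<open>S\<close>. A neighbour of \<open>p\<close> isolated by \<open>S'\<close> therefore lies
      in \<open>S\<close>, against the emptiness of \<open>?X'\<close>.\<close>
    obtain p where p: "p \<in> S'" using s'(11) by blast
    then have pS: "p \<in> iso S" using e s'(4) unfolding U_def by blast
    have "card (N p \<inter> iso S') \<noteq> 0" using card_iso_nbs(1)[OF s'(1) p] s'(2) k_pos by linarith
    then obtain q where "q \<in> N p" "q \<in> iso S'" by (metis IntE card.empty ex_in_conv)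
    then show False using e pS isoD(3) by blast
  qed
qed

text \<open>The extremal case of this lemma is a triangle, excluded by \<open>card_V\<close>; Kaneko's theorem fails for
  $K_3$ and $k = 1$.\<close>

lemma not_semi_blk_adjacent:
  assumes S: "semi_blk S a b" and S': "semi_blk S' a x" and x: "x \<noteq> b"
  shows False
proof -
  note s = semi_blkD[OF S] and s' = semi_blkD[OF S']
  let ?X = "iso S \<inter> S'" and ?X' = "iso S' \<inter> S"
  have bS': "b \<in> S'" using s'(7)[OF s(5)] x by blast
  have xS: "x \<in> S" using s(7)[OF s'(5)] x by blast
  define U where "U = (S \<union> S') - ?X - ?X' - {b, x}"
  have le: "slack U + slack (S \<inter> S') \<le> slack S + slack S'
      - int k * (int (card ?X) + int (card ?X')) - (int k + 1) * int (card {b, x}) - int (card ({}::'a set))"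
  proof (intro slack_uncross[where D = "{b, x}" and G = "{}"])
    show "{b, x} \<subseteq> S \<union> S' - ?X - ?X' - S \<inter> S'"
      using bS' xS s(4,10) s'(4,10) by blast
    show "d \<notin> N v" if "d \<in> {b, x}" "v \<in> iso S - ?X \<union> (iso S' - ?X')" for v d
      using that s(4,8,9) s'(4,8,9) isoD(3)[of v S] isoD(3)[of v S'] N_sym[of b v] N_sym[of x v] by blast
  qed (use s s' U_def in auto)
  have ge: "slack U \<ge> -1" "slack (S \<inter> S') \<ge> -1"
    using s(1) s'(1) unfolding U_def by (auto intro!: slack_ge)
  have "int 1 * (int (card ?X) + int (card ?X') + 2) \<le> int k * (int (card ?X) + int (card ?X') + 2)"
    using k_pos by (intro mult_right_mono) auto
  then have "slack U + slack (S \<inter> S') \<le> - (int (card ?X) + int (card ?X') + 2)"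
    using le s(2) s'(2) x by (simp add: algebra_simps)
  \<comment> \<open>Both slacks are at least -1, so the bound is attained and nothing is left of the
    union besides \<open>b\<close> and \<open>x\<close>. This pins down both sets and closes the
    triangle \<open>a\<close>, \<open>b\<close>, \<open>x\<close> under neighbours.\<close>
  then have "card ?X = 0" "card ?X' = 0" "slack U < 0" "slack (S \<inter> S') < 0" using ge by linarith+
  then have e: "?X = {}" "?X' = {}" "U = {}"
    using slack_neg_empty[of U] s(1) s'(1) finite_iso
    unfolding U_def by auto
  then have "S \<subseteq> {b, x}" "S' \<subseteq> {b, x}" unfolding U_def by blast+
  then have "S = {x}" "S' = {b}" using s(4) s'(4) xS bS' by blast+
  then have "N a \<subseteq> {a, b, x}" "N b \<subseteq> {a, b, x}" "N x \<subseteq> {a, b, x}"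
    using s(7,8) s'(8) by blast+
  moreover have "{a, b, x} \<subseteq> V" using s(1,5,6) xS N_sub by blast
  ultimately have "V = {a, b, x}" using conn unfolding nbs_closed_conn_def by blast
  then have "card V \<le> 3" by (simp add: card_insert_if)
  then show False using card_V by simp
qed

section \<open>Tight blocking sets along a cycle\<close>

text \<open>A vertex isolated only by the union stays isolated after trimming: a trimmed neighbour
  of it would be isolated by one of the sets, placing the vertex in that set.\<close>

lemma slack_uncross_gain:
  assumes "S \<subseteq> V" "S' \<subseteq> V" "slack S = 0" "slack S' = 0"
    and G: "\<And>a. a \<in> G \<Longrightarrow> a \<in> V - S - S' \<and> N a \<subseteq> S \<union> S' \<and> \<not> N a \<subseteq> S \<and> \<not> N a \<subseteq> S'"
  shows "slack ((S \<union> S') - (iso S \<inter> S') - (iso S' \<inter> S)) + slack (S \<inter> S') \<le>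
    - int k * (int (card (iso S \<inter> S')) + int (card (iso S' \<inter> S))) - int (card G)"
proof -
  let ?U = "(S \<union> S') - (iso S \<inter> S') - (iso S' \<inter> S)"
  have "slack ?U + slack (S \<inter> S') \<le> slack S + slack S'
      - int k * (int (card (iso S \<inter> S')) + int (card (iso S' \<inter> S)))
      - (int k + 1) * int (card ({} :: 'a set)) - int (card G)"
  proof (rule slack_uncross)
    show "G \<subseteq> iso ?U"
    proof
      fix a assume a: "a \<in> G"
      have "u \<in> ?U" if u: "u \<in> N a" for u
      proof -
        have "a \<in> N u" using u N_sym by blast
        then show ?thesis using u G[OF a] isoD(3)[of u S] isoD(3)[of u S'] by blast
      qed
      then show "a \<in> iso ?U" using G[OF a] by (intro isoI) blast+
    qed
    show "G \<inter> (iso S \<union> iso S') = {}" using G isoD(3) by blast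
  qed (use assms in auto)
  then show ?thesis using assms by simp
qed

text \<open>\<open>S\<close> is tight and contains \<open>x\<close>, whose blocked edge leads to
  \<open>a\<close>, a vertex not isolated by \<open>S\<close>;
  \<open>tight_vertex_not_blocked\<close> excludes this.\<close>

lemma blk_not_opposite:
  assumes S: "blk S a b" and x: "x \<in> N a" "x \<noteq> b" and S': "blk S' x a"
  shows False
proof -
  note s = blkD[OF S] and s' = blkD[OF S']
  have "x \<in> S" using s(8) x by blast
  then show False
    using tight_vertex_not_blocked[OF s(1) s'(1) s(2) s'(2) _ s'(4) s'(7) s(9)] by blast
qed

text \<open>Isolating \<open>a\<close> gains one, so the slacks sum to at most -1; the union keeps
  \<open>x\<close>, so the intersection must be empty. Any third neighbour of \<open>a\<close> would
  lie in it.\<close>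

lemma blk_both_nbs:
  assumes S: "blk S a b" and S': "blk S' a x" and x: "x \<noteq> b"
  shows "N a = {b, x}"
proof -
  note s = blkD[OF S] and s' = blkD[OF S']
  have xS: "x \<in> S" and bS': "b \<in> S'" using s(6,8) s'(6,8) x by blast+
  let ?U = "(S \<union> S') - (iso S \<inter> S') - (iso S' \<inter> S)"
  have le0: "slack ?U + slack (S \<inter> S') \<le>
    - int k * (int (card (iso S \<inter> S')) + int (card (iso S' \<inter> S))) - int (card {a})"
    using s s' x xS bS' by (intro slack_uncross_gain) auto
  have le: "slack ?U + slack (S \<inter> S') \<le> -1"
  proof -
    have "0 \<le> int k * (int (card (iso S \<inter> S')) + int (card (iso S' \<inter> S)))"
      by (intro mult_nonneg_nonneg) auto
    then show ?thesis using le0 is_singletonI[of a] unfolding is_singleton_altdef by linarith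
  qed
  have "x \<in> ?U" using xS s'(5,10) isoD(2)[of x S] by blast
  then have "slack ?U \<ge> 0" using s(1) s'(1) by (intro slack_nonneg) auto
  then have "S \<inter> S' = {}" using le slack_nonneg[of "S \<inter> S'"] s(1) by fastforce
  then show ?thesis using s(6,8) s'(6,8) by blast
qed

text \<open>
  The blocked ends alternate along the cycle, so every second vertex \<open>d (2 * j)\<close> has degree two. For a
  maximal set \<open>R\<close> blocking the first edge, some such vertex \<open>v\<close> has exactly one neighbour in \<open>R\<close>;
  uniting \<open>R\<close> with a set blocking at \<open>v\<close> isolates \<open>v\<close>, and either contradicts maximality or
  isolates \<open>d 0\<close> as well.
\<close>

lemma no_blocked_cycle:
  fixes c :: "nat \<Rightarrow> 'a"
  assumes nb: "\<And>j. c (Suc j) \<in> N (c j)"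
    and ne: "\<And>j. c (Suc (Suc j)) \<noteq> c j"
    and inj: "\<And>i j. c i = c j \<Longrightarrow> c (Suc i) = c (Suc j)"
    and t: "t > 0" and per: "\<And>j. c (j + t) = c j"
    and blocked: "\<And>j. \<exists>S. blk S (c j) (c (Suc j)) \<or> blk S (c (Suc j)) (c j)"
  shows False
proof -
  define F where "F j \<longleftrightarrow> (\<exists>S. blk S (c j) (c (Suc j)))" for j
  define B where "B j \<longleftrightarrow> (\<exists>S. blk S (c (Suc j)) (c j))" for j
  have FB: "F j \<or> B j" for j using blocked[of j] unfolding F_def B_def by blast
  \<comment> \<open>\<open>F\<close> and \<open>B\<close> record blocking at the first and at the
    second end. Consecutive edges cannot both be of the same kind, by
    \<open>blk_not_opposite\<close>, so the kinds alternate.\<close>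
  have 1: "\<not> F j" if "F (Suc j)" for j
    using that blk_not_opposite[of _ "c (Suc j)" "c (Suc (Suc j))" "c j"] nb[of j] ne[of j]
      N_sym[of "c j" "c (Suc j)"] unfolding F_def by metis
  have 2: "\<not> B (Suc j)" if "B j" for j
    using that blk_not_opposite[of _ "c (Suc j)" "c j" "c (Suc (Suc j))"] nb[of "Suc j"] ne[of j]
    unfolding B_def by metis
  have FS: "F (Suc (Suc j))" if "F j" for j using that 1 2 FB by blast
  obtain m where "F m" using 1 2 FB by blast
  define d where "d j = c (m + j)" for j
  have dnb: "d (Suc j) \<in> N (d j)" and dne: "d (Suc (Suc j)) \<noteq> d j"
    and dinj: "d i = d j \<Longrightarrow> d (Suc i) = d (Suc j)" for i j
    using nb[of "m + j"] ne[of "m + j"] inj[of "m + i" "m + j"] unfolding d_def by simp_all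
  have Feven: "F (m + 2 * j)" for j
  proof (induction j)
    case 0
    show ?case using \<open>F m\<close> by simp
  next
    case (Suc j)
    show ?case using FS[OF Suc] by simp
  qed
  then have dF: "\<exists>S. blk S (d (2 * j)) (d (Suc (2 * j)))" for j
    unfolding F_def d_def by simp
  have dB: "\<exists>S. blk S (d (2 * Suc j)) (d (Suc (2 * j)))" for j
  proof -
    have "B (m + Suc (2 * j))" using Feven[of "Suc j"] 1[of "m + Suc (2 * j)"] FB[of "m + Suc (2 * j)"] by simp
    then show ?thesis unfolding B_def d_def by simp
  qed
  have d_N: "N (d (2 * Suc j)) = {d (Suc (2 * Suc j)), d (Suc (2 * j))}" for j
    using dF[of "Suc j"] dB[of j] blk_both_nbs dne[of "Suc (2 * j)"] by fastforce
  define z where "z = d (Suc (2 * (t - 1)))"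
  \<comment> \<open>Going round twice keeps the parity of indices without a case split on the parity
    of \<open>t\<close>. Hence \<open>z\<close>, at index 2t - 1, is the cyclic predecessor of
    \<open>d 0\<close>.\<close>
  have per2: "d (2 * t + j) = d j" for j
    using per[of "m + j"] per[of "m + j + t"] unfolding d_def mult_2 by (simp add: ac_simps)
  have t2: "2 * Suc (t - 1) = 2 * t" using t by simp
  have N0: "N (d 0) = {d 1, z}"
    using d_N[of "t - 1"] per2[of 0] per2[of 1] unfolding t2 z_def by simp
  have z1: "z \<noteq> d 1"
    using dne[of "Suc (2 * (t - 1))"] per2[of 1] t2 unfolding z_def by (simp add: t2[simplified])
  obtain S0 where S0: "blk S0 (d 0) z"
    using dB[of "t - 1"] per2[of 0] unfolding t2 z_def by auto
  define M where "M = card ` {S. blk S (d 0) (d 1)}"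
  have "{S. blk S (d 0) (d 1)} \<subseteq> Pow V" unfolding blk_def by blast
  then have finM: "finite M" unfolding M_def
    using finite_V by (meson finite_Pow_iff finite_imageI finite_subset)
  moreover have "M \<noteq> {}" using dF[of 0] unfolding M_def by auto
  ultimately have "Max M \<in> M" by (rule Max_in)
  then obtain R where R: "blk R (d 0) (d 1)" and RM: "card R = Max M" unfolding M_def by auto
  have Rmax: "card S \<le> card R" if "blk S (d 0) (d 1)" for S
    unfolding RM using finM that by (intro Max_ge) (auto simp: M_def)
  note r = blkD[OF R]
  have zR: "z \<in> R" using N0 r(8)[of z] z1 by blast
  \<comment> \<open>Among the odd vertices the first, \<open>d 1\<close>, is outside
    \<open>R\<close> and the last, \<open>z\<close>, is inside, so membership switches on
    somewhere.\<close>
  have "\<exists>j. j < t - 1 \<and> d (Suc (2 * j)) \<notin> R \<and> d (Suc (2 * Suc j)) \<in> R"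
  proof (rule ccontr)
    assume a: "\<not> ?thesis"
    have "j \<le> t - 1 \<Longrightarrow> d (Suc (2 * j)) \<notin> R" for j
    proof (induction j)
      case 0
      then show ?case using r(5) by simp
    next
      case (Suc j)
      then have "j < t - 1" "d (Suc (2 * j)) \<notin> R" by simp_all
      then show ?case using a by blast
    qed
    then show False using zR unfolding z_def by blast
  qed
  then obtain j where j: "d (Suc (2 * j)) \<notin> R" "d (Suc (2 * Suc j)) \<in> R" by blast
  define v where "v = d (2 * Suc j)"
  define vp where "vp = d (Suc (2 * j))"
  define vn where "vn = d (Suc (2 * Suc j))"
  have vN: "N v = {vn, vp}" using d_N unfolding v_def vn_def vp_def by blast
  have vpR: "vp \<notin> R" and vnR: "vn \<in> R" using j unfolding vn_def vp_def by auto
  obtain S where S: "blk S v vn" using dF[of "Suc j"] unfolding v_def vn_def by blast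
  note s = blkD[OF S]
  have v0: "v \<noteq> d 0" using dinj[of "2 * Suc j" 0] r(5) vnR unfolding v_def vn_def by auto
  have vpn: "vp \<noteq> vn" using vpR vnR by blast
  then have vpS: "vp \<in> S" using s(8)[of vp] vN by blast
  \<comment> \<open>Otherwise \<open>v\<close> in the tight set \<open>R\<close> is blocked by
    \<open>S\<close> towards \<open>vn\<close>, which lies in \<open>R\<close> and so is not
    isolated by it.\<close>
  have vR: "v \<notin> R"
    using tight_vertex_not_blocked[OF r(1) s(1) r(2) s(2) _ s(4) s(7)] isoD(2) vnR by blast
  let ?X = "iso R \<inter> S" and ?X' = "iso S \<inter> R"
  let ?U = "(R \<union> S) - ?X - ?X'"
  have "slack ?U + slack (R \<inter> S) \<le> - int k * (int (card ?X) + int (card ?X')) - int (card {v})"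
    using r s vR vN vpR vnR vpS by (intro slack_uncross_gain) auto
  moreover have mono: "int 1 * (int (card ?X) + int (card ?X')) \<le> int k * (int (card ?X) + int (card ?X'))"
    using k_pos by (intro mult_right_mono) auto
  ultimately have le: "slack ?U + slack (R \<inter> S) \<le> - (int (card ?X) + int (card ?X')) - 1"
    by simp
  have "vn \<in> ?U" using vnR s(5,10) by blast
  then have U0: "slack ?U \<ge> 0" using r(1) s(1) by (intro slack_nonneg) auto
  then have RS: "R \<inter> S = {}" using le slack_nonneg[of "R \<inter> S"] r(1) by fastforce
  then have "slack (R \<inter> S) = -1" using slack_empty by simp
  then have "card ?X = 0" "card ?X' = 0" and Ut: "slack ?U = 0" using le U0 by linarith+
  then have X: "?X = {}" "?X' = {}" using finite_iso by auto
  then have Ut: "slack (R \<union> S) = 0" using Ut by simp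
  have z_iso: "z \<notin> iso S" using X zR by blast
  note s0 = blkD[OF S0]
  have d0S: "d 0 \<notin> S"
    using tight_vertex_not_blocked[OF s(1) s0(1) s(2) s0(2) _ s0(4) s0(7) z_iso] by blast
  have d1S: "d 1 \<notin> S"
  proof
    \<comment> \<open>Then the union isolates \<open>d 0\<close> as well as \<open>v\<close>, and a
      gain of two is one too many.\<close>
    assume d1: "d 1 \<in> S"
    have "slack ?U + slack (R \<inter> S) \<le> - int k * (int (card ?X) + int (card ?X')) - int (card {v, d 0})"
    proof (intro slack_uncross_gain)
      fix a assume "a \<in> {v, d 0}"
      then consider "a = v" | "a = d 0" by blast
      then show "a \<in> V - R - S \<and> N a \<subseteq> R \<union> S \<and> \<not> N a \<subseteq> R \<and> \<not> N a \<subseteq> S"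
      proof cases
        case 1
        then show ?thesis using r s vR vN vpR vnR vpS by auto
      next
        case 2
        then show ?thesis using r(3,4,5) d0S N0 d1 zR RS by auto
      qed
    qed (use r s in auto)
    then have "slack ?U + slack (R \<inter> S) \<le> - 2" using v0 X by simp
    then show False using \<open>slack (R \<inter> S) = -1\<close> U0 by linarith
  qed
  have "blk (R \<union> S) (d 0) (d 1)"
    unfolding blk_def using Ut r s(1) d0S d1S N0 zR by auto
  then have "card (R \<union> S) \<le> card R" by (rule Rmax)
  moreover have "card R < card (R \<union> S)"
    using vpS vpR r(1) s(1) finite_V by (intro psubset_card_mono) (auto intro: finite_subset)
  ultimately show False by simp
qed

section \<open>From edge-minimality to a spanning tree\<close>

text \<open>Only the two ends lose a neighbour, so at most two vertices become isolated, while a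
  violation needs at least \<open>slack S + 1\<close> new ones. The slack is therefore 0 or
  1.\<close>

lemma blk_if_deletion_violates:
  assumes b: "b \<in> N a" and S: "S \<subseteq> V" "S \<noteq> {}"
    and viol: "(k + 1) * card S \<le> card (isolated V (E - {{a, b}}) S)"
  shows "blk S a b \<or> blk S b a \<or> semi_blk S a b"
proof -
  let ?I = "isolated V (E - {{a, b}}) S"
  have ab: "a \<in> V" "b \<in> V" "a \<noteq> b" using b N_sym[of a b] N_sub N_irrefl by blast+
  have nbs': "nbs V (E - {{a, b}}) v = (if v = a then N a - {b} else if v = b then N b - {a} else N v)" for v
    using ab by (auto simp: nbs_def adj_def doubleton_eq_iff)
  have sub: "?I - iso S \<subseteq> {a, b}"
    unfolding isolated_def nbs' by (auto split: if_splits)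
  have new_a: "N a - S = {b} \<and> a \<notin> S" if "a \<in> ?I - iso S"
    using that b ab unfolding isolated_def nbs' by (auto split: if_splits)
  have new_b: "N b - S = {a} \<and> b \<notin> S" if "b \<in> ?I - iso S"
    using that b ab N_sym[of a b] unfolding isolated_def nbs' by (auto split: if_splits)
  have fin: "finite ?I" using finite_V by (simp add: isolated_def)
  have "card ?I \<le> card (iso S \<union> (?I - iso S))"
    using fin finite_iso by (intro card_mono) auto
  also have "\<dots> \<le> card (iso S) + card (?I - iso S)" by (rule card_Un_le)
  finally have "(k + 1) * card S \<le> card (iso S) + card (?I - iso S)" using viol by linarith
  then have "int ((k + 1) * card S) \<le> int (card (iso S) + card (?I - iso S))" by (rule of_nat_mono)
  then have "int (card (?I - iso S)) \<ge> slack S + 1"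
    unfolding slack_def by (simp add: algebra_simps)
  moreover have s0: "slack S \<ge> 0" using S by (rule slack_nonneg)
  ultimately consider "?I - iso S = {a}" "slack S = 0" | "?I - iso S = {b}" "slack S = 0"
    | "?I - iso S = {a, b}" "slack S = 0 \<or> slack S = 1"
  proof -
    assume *: "slack S + 1 \<le> int (card (?I - iso S))"
    have "?I - iso S = {} \<or> ?I - iso S = {a} \<or> ?I - iso S = {b} \<or> ?I - iso S = {a, b}"
      using sub by blast
    then consider "?I - iso S = {}" | "?I - iso S = {a}" | "?I - iso S = {b}" | "?I - iso S = {a, b}"
      by blast
    then show thesis
    proof cases
      case 1
      then have "card (?I - iso S) = 0" by (simp only: card.empty)
      then show thesis using * s0 by linarith
    next
      case 2
      then have "card (?I - iso S) = 1" by simp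
      then have "slack S = 0" using * s0 by linarith
      then show thesis using that(1) 2 by blast
    next
      case 3
      then have "card (?I - iso S) = 1" by simp
      then have "slack S = 0" using * s0 by linarith
      then show thesis using that(2) 3 by blast
    next
      case 4
      then have "card (?I - iso S) = 2" using ab by simp
      then have "slack S = 0 \<or> slack S = 1" using * s0 by linarith
      then show thesis using that(3) 4 by blast
    qed
  qed
  then show ?thesis
  proof cases
    case 1
    then show ?thesis using new_a S ab unfolding blk_def by blast
  next
    case 2
    then show ?thesis using new_b S ab unfolding blk_def by blast
  next
    case 3
    then have "N a - S = {b} \<and> a \<notin> S" "N b - S = {a} \<and> b \<notin> S" using new_a new_b by blast+
    \<comment> \<open>If both ends become isolated but the slack is 0, \<open>S\<close> is already a
      \<open>blk\<close> set.\<close>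
    then show ?thesis using 3(2) S ab unfolding blk_def semi_blk_def by blast
  qed
qed

text \<open>A \<open>semi_blk\<close> edge is impossible, because each way of blocking the next edge
  contradicts one of the three incompatibility lemmas at the common vertex. What remains is
  \<open>no_blocked_cycle\<close>.\<close>

lemma no_weakly_blocked_cycle:
  fixes c :: "nat \<Rightarrow> 'a"
  assumes nb: "\<And>j. c (Suc j) \<in> N (c j)"
    and ne: "\<And>j. c (Suc (Suc j)) \<noteq> c j"
    and inj: "\<And>i j. c i = c j \<Longrightarrow> c (Suc i) = c (Suc j)"
    and t: "t > 0" and per: "\<And>j. c (j + t) = c j"
    and blocked: "\<And>j. \<exists>S. blk S (c j) (c (Suc j)) \<or> blk S (c (Suc j)) (c j) \<or> semi_blk S (c j) (c (Suc j))"
  shows False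
proof (rule no_blocked_cycle[OF nb ne inj t per])
  fix j
  have "\<not> semi_blk S (c j) (c (Suc j))" for S
  proof
    assume "semi_blk S (c j) (c (Suc j))"
    then have s: "semi_blk S (c (Suc j)) (c j)" unfolding semi_blk_def by simp
    \<comment> \<open>The cyclic predecessor of \<open>c j\<close>, with \<open>t\<close> added so
      that j = 0 is covered.\<close>
    have y: "c (j + t - 1) \<in> N (c j)" "c (j + t - 1) \<noteq> c (Suc j)"
      using nb[of "j + t - 1"] ne[of "j + t - 1"] t per[of j] per[of "Suc j"] N_sym by (auto simp: Suc_diff_Suc)
    from blocked[of "Suc j"] show False
      using not_semi_blk_and_blk[OF s _ ne] not_semi_blk_and_blk_opposite[OF s _ ne y]
        not_semi_blk_adjacent[OF s _ ne] by blast
  qed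
  then show "\<exists>S. blk S (c j) (c (Suc j)) \<or> blk S (c (Suc j)) (c j)" using blocked by blast
qed

end

text \<open>A closed set of the smaller graph containing one end of the deleted edge reaches the
  other end along the rest of the cycle, so it is closed in the original graph too.\<close>

lemma nbs_closed_conn_delete_cycle_edge:
  fixes c :: "nat \<Rightarrow> 'a"
  assumes "simple_graph V E" and conn: "nbs_closed_conn V E"
    and c: "\<And>j. adj E (c j) (c (Suc j))"
    and inj: "\<And>i j. c i = c j \<longleftrightarrow> i mod t = j mod t" and t: "t \<ge> 3"
  shows "nbs_closed_conn V (E - {{c j, c (Suc j)}})"
proof -
  let ?a = "c j" and ?b = "c (Suc j)"
  let ?E = "E - {{?a, ?b}}"
  have cV: "c i \<in> V" for i using simple_graph_adjD(1)[OF assms(1) c] .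
  have b_a: "?a \<in> W" if W: "W \<subseteq> V" "\<forall>v\<in>W. nbs V ?E v \<subseteq> W" "?b \<in> W" for W
  proof -
    have "m < t \<Longrightarrow> c (Suc j + m) \<in> W" for m
    proof (induction m)
      case 0
      then show ?case using W by simp
    next
      case (Suc m)
      have "\<not> t dvd Suc m" using Suc.prems by (meson dvd_imp_le not_le zero_less_Suc)
      then have 1: "c (Suc j + m) \<noteq> c j"
        unfolding inj using mod_eq_dvd_iff_nat[of j "Suc j + m" t] by simp
      \<comment> \<open>Together with the previous fact, this keeps the step from being the deleted
        edge in either direction; the start m = 0 needs t not to divide 2.\<close>
      have 2: "c (Suc j + Suc m) \<noteq> c j \<or> c (Suc j + m) \<noteq> c (Suc j)"
      proof (cases "m = 0")
        case True
        have "\<not> t dvd 2" using t by (auto dest: dvd_imp_le)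
        then show ?thesis
          unfolding inj using mod_eq_dvd_iff_nat[of j "Suc (Suc j)" t] True by simp
      next
        case False
        then have "\<not> t dvd m" using Suc.prems by (auto dest: dvd_imp_le)
        then show ?thesis
          unfolding inj using mod_eq_dvd_iff_nat[of "Suc j" "Suc j + m" t] by simp
      qed
      have "{c (Suc j + m), c (Suc j + Suc m)} \<noteq> {?a, ?b}"
        using 1 2 by (auto simp: doubleton_eq_iff)
      then have "c (Suc j + Suc m) \<in> nbs V ?E (c (Suc j + m))"
        using c[of "Suc j + m"] cV unfolding nbs_def adj_def by simp
      then show ?case using Suc W(2) by auto
    qed
    from this[of "t - 1"] have "c (j + t) \<in> W" using t by simp
    moreover have "c (j + t) = c j" unfolding inj by simp
    ultimately show ?thesis by simp
  qed
  show ?thesis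
    unfolding nbs_closed_conn_def
  proof (intro conjI allI impI)
    show "V \<noteq> {}" using cV by blast
    fix W assume W: "W \<subseteq> V" "W \<noteq> {}" "\<forall>v\<in>W. nbs V ?E v \<subseteq> W"
    have a_b: "?b \<in> W" if "?a \<in> W"
    proof (rule ccontr)
      assume "?b \<notin> W"
      \<comment> \<open>By symmetry of adjacency the complement of a closed set is closed, so the
        reverse implication follows from \<open>b_a\<close> applied to the complement.\<close>
      have "\<forall>v\<in>V - W. nbs V ?E v \<subseteq> V - W"
      proof (intro ballI subsetI)
        fix v u assume v: "v \<in> V - W" and u: "u \<in> nbs V ?E v"
        then have "v \<in> nbs V ?E u" unfolding nbs_def adj_def by (auto simp: insert_commute)
        then show "u \<in> V - W" using v u W(3) unfolding nbs_def by blast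
      qed
      then have "?a \<in> V - W" using \<open>?b \<notin> W\<close> cV by (intro b_a) auto
      then show False using that by blast
    qed
    have "\<forall>v\<in>W. nbs V E v \<subseteq> W"
    proof (intro ballI subsetI)
      fix v u assume v: "v \<in> W" and u: "u \<in> nbs V E v"
      show "u \<in> W"
      proof (cases "{v, u} = {?a, ?b}")
        case True
        then show ?thesis using v a_b b_a[OF W(1,3)] by (auto simp: doubleton_eq_iff)
      next
        case False
        then have "u \<in> nbs V ?E v" using u unfolding nbs_def adj_def by auto
        then show ?thesis using v W(3) by blast
      qed
    qed
    then show "W = V" using conn W unfolding nbs_closed_conn_def by blast
  qed
qed

theorem kaneko_spanning_tree:
  assumes simple: "simple_graph V E" and conn: "connected_graph V E" and "card V \<ge> 4" and "k \<ge> 1"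
    and iso: "\<And>S. S \<subseteq> V \<Longrightarrow> S \<noteq> {} \<Longrightarrow> card (isolated V E S) < (k + 1) * card S"
  shows "\<exists>T. spanning_tree V E T \<and> leaf_degree V T \<le> k"
proof -
  define P where "P T \<longleftrightarrow> T \<subseteq> E \<and> nbs_closed_conn V T \<and>
    (\<forall>S. S \<subseteq> V \<longrightarrow> S \<noteq> {} \<longrightarrow> card (isolated V T S) < (k + 1) * card S)" for T
  have "P E" unfolding P_def using iso conn by (simp add: connected_graph_iff_nbs_closed_conn)
  then obtain T where T: "P T" and Tmin: "\<And>T'. P T' \<Longrightarrow> card T \<le> card T'"
    using ex_has_least_nat[of P E card] by blast
  have TE: "T \<subseteq> E" using T unfolding P_def by simp
  then have simpleT: "simple_graph V T" using simple unfolding simple_graph_def by (meson subsetD)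
  have finV: "finite V" using simple by (simp add: simple_graph_def)
  have "T \<subseteq> Pow V"
  proof
    fix e assume "e \<in> T"
    then obtain u v where "e = {u, v}" "u \<in> V" "v \<in> V" using simpleT unfolding simple_graph_def by meson
    then show "e \<in> Pow V" by simp
  qed
  then have finT: "finite T" using finV by (meson finite_Pow_iff finite_subset)
  interpret L: leaf_bound_graph V T k
    using simpleT \<open>k \<ge> 1\<close> by (rule leaf_bound_graph.intro)
  have slack: "L.slack S \<ge> 0" if "S \<subseteq> V" "S \<noteq> {}" for S
  proof -
    have "card (isolated V T S) < (k + 1) * card S" using T that unfolding P_def by blast
    then have "int (card (isolated V T S)) < int ((k + 1) * card S)" by (rule of_nat_less_iff[THEN iffD2])
    then show ?thesis unfolding L.slack_def by (simp add: algebra_simps)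
  qed
  have "nbs_closed_conn V T" using T unfolding P_def by simp
  then interpret K: kaneko_graph V T k
    using slack \<open>card V \<ge> 4\<close>
    by (intro kaneko_graph.intro L.leaf_bound_graph_axioms kaneko_graph_axioms.intro)
  have "\<not> has_cycle V T"
  proof
    assume "has_cycle V T"
    then obtain p where p: "walk V T p" "distinct p" "length p \<ge> 3" "adj T (last p) (hd p)"
      unfolding has_cycle_def by blast
    define t where "t = length p"
    have t3: "t \<ge> 3" using p t_def by simp
    define c where "c j = p ! (j mod t)" for j
    have inj: "c i = c j \<longleftrightarrow> i mod t = j mod t" for i j
    proof -
      have "0 < length p" using p(3) by linarith
      then have "i mod t < length p" "j mod t < length p" unfolding t_def by simp_all
      then show ?thesis using p(2) unfolding c_def by (simp add: nth_eq_iff_index_eq)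
    qed
    have cadj: "adj T (c j) (c (Suc j))" for j
    proof (cases "Suc (j mod t) = t")
      case True
      then have "j mod t = length p - 1" unfolding t_def by simp
      moreover have "Suc j mod t = 0" using True by (simp add: mod_Suc)
      moreover have "p \<noteq> []" using p(3) by auto
      ultimately show ?thesis
        using p(4) unfolding c_def by (simp add: last_conv_nth hd_conv_nth)
    next
      case False
      moreover have "j mod t < t" using t3 by simp
      ultimately have "Suc (j mod t) < length p" unfolding t_def by simp
      then show ?thesis using p(1) False unfolding c_def walk_def by (simp add: mod_Suc)
    qed
    show False
    proof (rule K.no_weakly_blocked_cycle[of c t])
      show nb: "c (Suc j) \<in> nbs V T (c j)" for j
        using cadj simple_graph_adjD(2)[OF simpleT cadj] unfolding nbs_def by blast
      show "c (Suc (Suc j)) \<noteq> c j" for j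
      proof -
        have "\<not> t dvd 2" using t3 by (auto dest: dvd_imp_le)
        then show ?thesis unfolding inj using mod_eq_dvd_iff_nat[of j "Suc (Suc j)" t] by simp
      qed
      show "c (Suc i) = c (Suc j)" if "c i = c j" for i j
        using that unfolding inj mod_Suc[of i] mod_Suc[of j] by simp
      show "t > 0" using t3 by simp
      show "c (j + t) = c j" for j unfolding inj by simp
      fix j
      let ?T = "T - {{c j, c (Suc j)}}"
      have "card ?T < card T"
        using cadj[of j] finT unfolding adj_def by (intro card_Diff1_less)
      then have "\<not> P ?T" using Tmin[of ?T] by linarith
      moreover have "nbs_closed_conn V ?T"
        by (rule nbs_closed_conn_delete_cycle_edge[OF simpleT \<open>nbs_closed_conn V T\<close> cadj inj t3])
      ultimately obtain S where "S \<subseteq> V" "S \<noteq> {}" "(k + 1) * card S \<le> card (isolated V ?T S)"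
        using TE unfolding P_def not_less[symmetric] by blast
      then show "\<exists>S. K.blk S (c j) (c (Suc j)) \<or> K.blk S (c (Suc j)) (c j) \<or> K.semi_blk S (c j) (c (Suc j))"
        using K.blk_if_deletion_violates[OF nb] by blast
    qed
  qed
  then have "is_tree V T"
    using simpleT T unfolding is_tree_def P_def by (simp add: connected_graph_iff_nbs_closed_conn)
  then have "spanning_tree V E T" using T unfolding spanning_tree_def P_def by blast
  moreover have "leaf_degree V T \<le> k"
  proof -
    have "vertex_leaf_degree V T v \<le> k" if v: "v \<in> V" for v
    proof -
      have "{u \<in> V. adj T v u \<and> is_leaf V T u} \<subseteq> isolated V T {v}"
      proof
        fix u assume u: "u \<in> {u \<in> V. adj T v u \<and> is_leaf V T u}"
        then have "card (nbs V T u) = 1" by (simp add: is_leaf_def Defs.degree_def nbs_def)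
        moreover have "v \<in> nbs V T u" using u v adj_sym[of T v u] by (simp add: nbs_def)
        ultimately have "nbs V T u = {v}" by (metis card_1_singletonE singletonD)
        moreover have "u \<noteq> v" using u simple_graph_adjD(3)[OF simpleT] by blast
        ultimately show "u \<in> isolated V T {v}" using u by (simp add: isolated_def)
      qed
      then have "vertex_leaf_degree V T v \<le> card (isolated V T {v})"
        unfolding vertex_leaf_degree_def using L.finite_iso by (intro card_mono)
      also have "\<dots> < (k + 1) * card {v}" using T v unfolding P_def by blast
      finally show ?thesis by simp
    qed
    moreover have "V \<noteq> {}" using \<open>card V \<ge> 4\<close> by auto
    ultimately show ?thesis unfolding leaf_degree_def using finV by simp
  qed
  ultimately show ?thesis by blast
qed

section \<open>Spectral radius\<close>

lemma adj_eigenvalue_iff_eigenvalue: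
  fixes E :: "'a set set"
  assumes h: "bij_betw h {0..<n} V"
  defines "A \<equiv> mat n n (\<lambda>(i, j). if adj E (h i) (h j) then 1 else 0 :: complex)"
  shows "adj_eigenvalue V E \<mu> \<longleftrightarrow> eigenvalue A \<mu>"
proof -
  have A: "A \<in> carrier_mat n n" unfolding A_def by simp
  have sumV: "(\<Sum>w\<in>V. f w) = (\<Sum>j\<in>{0..<n}. f (h j))" for f :: "'a \<Rightarrow> complex"
    using sum.reindex_bij_betw[OF h, of f] by simp
  have mult: "(A *\<^sub>v v) $ i = (\<Sum>j\<in>{0..<n}. (if adj E (h i) (h j) then 1 else 0) * v $ j)"
    if "i < n" "v \<in> carrier_vec n" for v i
    using that unfolding A_def by (simp add: scalar_prod_def)
  have hV: "h i \<in> V" if "i < n" for i using h that by (auto simp: bij_betw_def)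
  show ?thesis
  proof
    assume "adj_eigenvalue V E \<mu>"
    then obtain x where x0: "\<exists>v\<in>V. x v \<noteq> 0"
      and x: "\<forall>u\<in>V. (\<Sum>w\<in>V. (if adj E u w then 1 else 0) * x w) = \<mu> * x u"
      unfolding adj_eigenvalue_def by blast
    define v where "v = vec n (\<lambda>i. x (h i))"
    have v: "v \<in> carrier_vec n" unfolding v_def by simp
    from x0 obtain i where "i < n" "x (h i) \<noteq> 0" using h by (force simp: bij_betw_def)
    then have "v \<noteq> 0\<^sub>v n" unfolding v_def by (metis index_vec index_zero_vec(1))
    moreover have "A *\<^sub>v v = \<mu> \<cdot>\<^sub>v v"
    proof (rule eq_vecI)
      show "dim_vec (A *\<^sub>v v) = dim_vec (\<mu> \<cdot>\<^sub>v v)" using A v by simp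
      fix i assume "i < dim_vec (\<mu> \<cdot>\<^sub>v v)"
      then have i: "i < n" using v by simp
      have "(A *\<^sub>v v) $ i = (\<Sum>j\<in>{0..<n}. (if adj E (h i) (h j) then 1 else 0) * x (h j))"
        unfolding mult[OF i v] by (intro sum.cong) (auto simp: v_def)
      also have "\<dots> = \<mu> * x (h i)" 
        using x[rule_format, OF hV[OF i]] sumV[of "\<lambda>w. (if adj E (h i) w then 1 else 0) * x w"] by simp
      finally show "(A *\<^sub>v v) $ i = (\<mu> \<cdot>\<^sub>v v) $ i" using i by (simp add: v_def)
    qed
    ultimately show "eigenvalue A \<mu>"
      using v A unfolding eigenvalue_def eigenvector_def by auto
  next
    assume "eigenvalue A \<mu>"
    then obtain v where v: "v \<in> carrier_vec n" "v \<noteq> 0\<^sub>v n" "A *\<^sub>v v = \<mu> \<cdot>\<^sub>v v"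
      using A unfolding eigenvalue_def eigenvector_def by auto
    define x where "x w = v $ (inv_into {0..<n} h w)" for w
    have xh: "x (h j) = v $ j" if "j < n" for j
      using that h unfolding x_def by (simp add: bij_betw_def inv_into_f_f)
    obtain i where "i < n" "v $ i \<noteq> 0"
      using v(1,2) by (metis carrier_vecD eq_vecI index_zero_vec(1) index_zero_vec(2))
    then have x0: "\<exists>v\<in>V. x v \<noteq> 0" using xh hV by metis
    have "(\<Sum>w\<in>V. (if adj E u w then 1 else 0) * x w) = \<mu> * x u" if uV: "u \<in> V" for u
    proof -
      obtain i where i: "i < n" "u = h i" using uV h by (force simp: bij_betw_def)
      have "(\<Sum>w\<in>V. (if adj E u w then 1 else 0) * x w) = (A *\<^sub>v v) $ i"
        unfolding sumV mult[OF i(1) v(1)] i(2) by (intro sum.cong) (auto simp: xh)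
      also have "\<dots> = \<mu> * x u" using v i xh by simp
      finally show ?thesis .
    qed
    then show "adj_eigenvalue V E \<mu>" unfolding adj_eigenvalue_def using x0 by blast
  qed
qed

text \<open>The \<open>Max\<close> in \<open>spectral_radius\<close> is meaningful: the
  characteristic polynomial is nonzero and, for nonempty \<open>V\<close>, nonconstant, so its root
  set is finite and nonempty.\<close>

lemma adj_eigenvalue_moduli:
  assumes "finite V" "V \<noteq> {}"
  shows "finite {cmod \<mu> | \<mu>. adj_eigenvalue V E \<mu>}" "{cmod \<mu> | \<mu>. adj_eigenvalue V E \<mu>} \<noteq> {}"
proof -
  obtain h where h: "bij_betw h {0..<card V} V"
    using ex_bij_betw_nat_finite[OF assms(1)] by blast
  define A where "A = mat (card V) (card V) (\<lambda>(i, j). if adj E (h i) (h j) then 1 else 0 :: complex)"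
  have A: "A \<in> carrier_mat (card V) (card V)" unfolding A_def by simp
  have ev: "adj_eigenvalue V E \<mu> \<longleftrightarrow> poly (char_poly A) \<mu> = 0" for \<mu>
    using adj_eigenvalue_iff_eigenvalue[OF h] eigenvalue_root_char_poly[OF A] unfolding A_def by blast
  have deg: "Polynomial.degree (char_poly A) = card V" and monic: "lead_coeff (char_poly A) = 1"
    using degree_monic_char_poly[OF A] by auto
  have "char_poly A \<noteq> 0" using monic by auto
  then have "finite {\<mu>. adj_eigenvalue V E \<mu>}" unfolding ev by (rule poly_roots_finite)
  then show "finite {cmod \<mu> | \<mu>. adj_eigenvalue V E \<mu>}" by (auto simp: setcompr_eq_image)
  have "card V > 0" using assms by auto
  then have "\<not> constant (poly (char_poly A))" unfolding constant_degree deg by simp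
  then show "{cmod \<mu> | \<mu>. adj_eigenvalue V E \<mu>} \<noteq> {}"
    using fundamental_theorem_of_algebra unfolding ev by blast
qed

lemma cmod_le_spectral_radius:
  assumes "finite V" "V \<noteq> {}" "adj_eigenvalue V E \<mu>"
  shows "cmod \<mu> \<le> spectral_radius V E"
  unfolding spectral_radius_def using assms adj_eigenvalue_moduli[of V E] by (intro Max_ge) auto

lemma spectral_radius_attained:
  assumes "finite V" "V \<noteq> {}"
  obtains \<mu> where "adj_eigenvalue V E \<mu>" "cmod \<mu> = spectral_radius V E"
  using Max_in[OF adj_eigenvalue_moduli[OF assms, of E]] unfolding spectral_radius_def by fastforce

lemma adj_sum_eq_nbs_sum:
  fixes x :: "'a \<Rightarrow> 'b::semiring_1"
  assumes "finite V"
  shows "(\<Sum>w\<in>V. (if adj E u w then 1 else 0) * x w) = (\<Sum>w\<in>nbs V E u. x w)"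
  unfolding nbs_def using assms by (simp add: sum.inter_filter if_distrib[where f = "\<lambda>c. c * _"] cong: if_cong)

text \<open>With y the moduli of an eigenvector and m = |\<mu>|, the triangle inequality gives A y
  \<ge> m y, while A x \<le> \<rho> x \<le> m x. Pairing the first with x and the second with y
  makes the total vanish, so every term is zero. Connectivity rules out zeros of y, whence A x = m
  x.\<close>

lemma supersolution_eq_if_large_eigenvalue:
  assumes simple: "simple_graph V E" and conn: "connected_graph V E"
    and x: "\<And>u. u \<in> V \<Longrightarrow> x u > (0::real)"
    and super: "\<And>u. u \<in> V \<Longrightarrow> (\<Sum>w\<in>nbs V E u. x w) \<le> \<rho> * x u"
    and \<mu>: "adj_eigenvalue V E \<mu>" "cmod \<mu> \<ge> \<rho>"
    and u: "u \<in> V"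
  shows "(\<Sum>w\<in>nbs V E u. x w) = \<rho> * x u"
proof -
  have fin: "finite V" using simple by (simp add: simple_graph_def)
  have finN: "finite (nbs V E v)" for v using fin by (simp add: nbs_def)
  define m where "m = cmod \<mu>"
  obtain z where z0: "\<exists>v\<in>V. z v \<noteq> 0" and z: "\<And>v. v \<in> V \<Longrightarrow> (\<Sum>w\<in>nbs V E v. z w) = \<mu> * z v"
    using \<mu>(1) unfolding adj_eigenvalue_def adj_sum_eq_nbs_sum[OF fin] by blast
  define y where "y v = cmod (z v)" for v
  have y0: "y v \<ge> 0" for v by (simp add: y_def)
  define p where "p v = x v * ((\<Sum>w\<in>nbs V E v. y w) - m * y v)" for v
  define q where "q v = y v * (m * x v - (\<Sum>w\<in>nbs V E v. x w))" for v
  have p: "p v \<ge> 0" if "v \<in> V" for v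
  proof -
    have "m * y v = cmod (\<Sum>w\<in>nbs V E v. z w)"
      using z[OF that] by (simp add: m_def y_def norm_mult)
    also have "\<dots> \<le> (\<Sum>w\<in>nbs V E v. y w)" unfolding y_def by (rule norm_sum)
    finally show ?thesis using x[OF that] by (simp add: p_def)
  qed
  have mx: "\<rho> * x v \<le> m * x v" if "v \<in> V" for v
    using x[OF that] \<mu>(2) by (intro mult_right_mono) (auto simp: m_def)
  have q: "q v \<ge> 0" if "v \<in> V" for v
    using y0[of v] mx[OF that] super[OF that] by (simp add: q_def)
  \<comment> \<open>Symmetry of the adjacency matrix; the terms with \<open>m\<close> cancel between
    \<open>p\<close> and \<open>q\<close>.\<close>
  have "(\<Sum>v\<in>V. x v * (\<Sum>w\<in>nbs V E v. y w)) = (\<Sum>v\<in>V. \<Sum>w\<in>V. if adj E v w then x v * y w else 0)"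
    unfolding nbs_def using fin
    by (simp add: sum_distrib_left sum.inter_filter if_distrib[where f = "\<lambda>c. _ * c"] cong: if_cong)
  also have "\<dots> = (\<Sum>w\<in>V. \<Sum>v\<in>V. if adj E w v then y w * x v else 0)"
    by (subst sum.swap) (intro sum.cong, auto simp: adj_sym mult.commute)
  also have "\<dots> = (\<Sum>v\<in>V. y v * (\<Sum>w\<in>nbs V E v. x w))"
    unfolding nbs_def using fin
    by (simp add: sum_distrib_left sum.inter_filter if_distrib[where f = "\<lambda>c. _ * c"] cong: if_cong)
  finally have "(\<Sum>v\<in>V. p v + q v) = 0"
    unfolding p_def q_def by (simp add: sum.distrib sum_subtractf algebra_simps)
  then have pq: "p v = 0 \<and> q v = 0" if "v \<in> V" for v
    using that p q fin
    by (subst (asm) sum_nonneg_eq_0_iff) (auto simp: add_nonneg_eq_0_iff)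
  define W where "W = {v \<in> V. y v = 0}"
  have "nbs V E v \<subseteq> W" if v: "v \<in> W" for v
  proof -
    have "v \<in> V" "y v = 0" using v by (auto simp: W_def)
    then have "(\<Sum>w\<in>nbs V E v. y w) = 0" using pq[of v] x[of v] by (auto simp: p_def)
    then have "\<forall>w\<in>nbs V E v. y w = 0" using finN y0 by (subst (asm) sum_nonneg_eq_0_iff) auto
    then show ?thesis by (auto simp: W_def nbs_def)
  qed
  moreover have "W \<noteq> V" using z0 by (auto simp: W_def y_def)
  moreover have "W \<subseteq> V" by (auto simp: W_def)
  ultimately have "W = {}"
    using conn unfolding connected_graph_iff_nbs_closed_conn nbs_closed_conn_def by blast
  then have "y u \<noteq> 0" using u by (auto simp: W_def)
  then have "m * x u = (\<Sum>w\<in>nbs V E u. x w)" using pq[OF u] by (simp add: q_def)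
  then show ?thesis using mx[OF u] super[OF u] by linarith
qed

section \<open>Weights and quotient polynomial of the three-part graph\<close>

text \<open>The weights come from solving the eigenvalue equations on \<open>I\<close> and
  \<open>B\<close> with weight 1 on \<open>S\<close>: \<rho> x = s on \<open>I\<close>, and \<rho> x
  = s + (b - 1) x on \<open>B\<close>, where b is the size of \<open>B\<close>. Only the rows of
  \<open>S\<close> can then fail.\<close>

lemma joined_graph_weight_sums:
  fixes \<rho> :: real
  assumes "finite S" "finite I" "finite B" and disj: "S \<inter> I = {}" "S \<inter> B = {}" "I \<inter> B = {}"
    and pos: "\<rho> > 0" "\<rho> + 1 - real (card B) > 0"
  defines "s \<equiv> real (card S)"
  defines "x \<equiv> \<lambda>v. if v \<in> S then 1 else if v \<in> I then s / \<rho> else s / (\<rho> + 1 - real (card B))"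
  shows "v \<in> S \<Longrightarrow> sum x (S \<union> I \<union> B - {v}) = s - 1 + real (card I) * (s / \<rho>)
           + real (card B) * (s / (\<rho> + 1 - real (card B)))"
    and "sum x S = s"
    and "v \<in> B \<Longrightarrow> sum x (S \<union> B - {v}) = \<rho> * (s / (\<rho> + 1 - real (card B)))"
proof -
  show S: "sum x S = s" by (simp add: x_def s_def)
  have I: "sum x I = real (card I) * (s / \<rho>)"
  proof -
    have "sum x I = sum (\<lambda>_. s / \<rho>) I" using disj by (intro sum.cong) (auto simp: x_def)
    then show ?thesis by simp
  qed
  have B: "sum x B = real (card B) * (s / (\<rho> + 1 - real (card B)))"
  proof -
    have "sum x B = sum (\<lambda>_. s / (\<rho> + 1 - real (card B))) B" using disj by (intro sum.cong) (auto simp: x_def)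
    then show ?thesis by simp
  qed
  have SB: "sum x (S \<union> B) = s + real (card B) * (s / (\<rho> + 1 - real (card B)))"
    using assms S B by (subst sum.union_disjoint) auto
  have "sum x (S \<union> B \<union> I) = sum x (S \<union> B) + sum x I"
    using assms by (intro sum.union_disjoint) auto
  moreover have "S \<union> I \<union> B = S \<union> B \<union> I" by blast
  ultimately have SIB: "sum x (S \<union> I \<union> B) = s + real (card I) * (s / \<rho>) + real (card B) * (s / (\<rho> + 1 - real (card B)))"
    using SB I by simp
  show "sum x (S \<union> I \<union> B - {v}) = s - 1 + real (card I) * (s / \<rho>)
           + real (card B) * (s / (\<rho> + 1 - real (card B)))" if "v \<in> S"
    using SIB that assms(1-3) by (subst sum_diff1) (auto simp: x_def)
  show "sum x (S \<union> B - {v}) = \<rho> * (s / (\<rho> + 1 - real (card B)))" if v: "v \<in> B"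
  proof -
    have "x v = s / (\<rho> + 1 - real (card B))" using v disj by (auto simp: x_def)
    then have "sum x (S \<union> B - {v}) = s + real (card B) * (s / (\<rho> + 1 - real (card B))) - s / (\<rho> + 1 - real (card B))"
      using SB v assms(1-3) by (subst sum_diff1) auto
    also have "\<dots> = \<rho> * (s / (\<rho> + 1 - real (card B)))"
      using pos(2) by (simp add: divide_simps) (simp add: algebra_simps)
    finally show ?thesis .
  qed
qed

text \<open>The characteristic polynomial of the quotient matrix of
  $K_s \vee (K_{n-(K+1)s} + I_{Ks})$, where $K = k + 1$.\<close>

definition quotient_poly :: "real \<Rightarrow> real \<Rightarrow> real \<Rightarrow> real \<Rightarrow> real" where
  "quotient_poly n K s r = r * (r + 1) * (r + 1 - n + K * s) - K * s\<^sup>2 * (r + 1 - n + (K + 1) * s)"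

text \<open>The defect of the weight vector in a row of \<open>S\<close> has the sign of
  \<open>quotient_poly\<close>.\<close>

lemma quotient_row:
  fixes n K s r b :: real
  assumes b: "b = n - (K + 1) * s" and "r > 0" "r + 1 - b > 0"
  shows "r - (s - 1 + K * s * (s / r) + b * (s / (r + 1 - b))) = quotient_poly n K s r / (r * (r + 1 - b))"
proof -
  have "r - (s - 1 + K * s * (s / r) + b * (s / (r + 1 - b))) =
    ((r + 1 - s) * (r * (r + 1 - b)) - K * s\<^sup>2 * (r + 1 - b) - b * s * r) / (r * (r + 1 - b))"
    using assms(2,3) by (simp add: divide_simps power2_eq_square) (simp add: algebra_simps)
  also have "(r + 1 - s) * (r * (r + 1 - b)) - K * s\<^sup>2 * (r + 1 - b) - b * s * r = quotient_poly n K s r"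
    unfolding quotient_poly_def b by (simp add: algebra_simps power2_eq_square)
  finally show ?thesis .
qed

text \<open>The endpoints are the spectral radii of the clique on n - Kd vertices inside the graph
  and of the complete graph on n vertices; the polynomial changes sign between them.\<close>

lemma quotient_poly_root:
  fixes n K d :: real
  assumes "K \<ge> 2" "d \<ge> 1" and n: "n \<ge> 3 * (K + 1) * d + 2"
  obtains r where "quotient_poly n K d r = 0" "r \<ge> n - K * d - 1" "r \<le> n - 1"
proof -
  let ?l = "n - K * d - 1"
  have "quotient_poly n K d ?l = - (K * d ^ 3)"
    unfolding quotient_poly_def by (simp add: algebra_simps power2_eq_square power3_eq_cube)
  then have lo: "quotient_poly n K d ?l \<le> 0" using assms by simp
  have e: "quotient_poly n K d (n - 1) = K * d * (n * (n - 1) - (K + 1) * d\<^sup>2)"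
    unfolding quotient_poly_def by (simp add: algebra_simps power2_eq_square)
  have Kd: "(K + 1) * d \<ge> 3 * 1" using assms by (intro mult_mono) auto
  have n': "n \<ge> 3 * ((K + 1) * d) + 2" using n by (simp only: mult.assoc)
  have "(K + 1) * d * d \<le> n * (n - 1)"
  proof (intro mult_mono)
    show "(K + 1) * d \<le> n" using n' Kd by linarith
    have "1 * d \<le> (K + 1) * d" using assms by (intro mult_right_mono) auto
    then show "d \<le> n - 1" using n' Kd by linarith
  qed (use assms n' Kd in linarith)+
  then have hi: "quotient_poly n K d (n - 1) \<ge> 0"
    unfolding e using assms by (intro mult_nonneg_nonneg) (auto simp: power2_eq_square)
  have "?l \<le> n - 1" using assms by simp
  moreover have "continuous_on {?l..n - 1} (quotient_poly n K d)"
    unfolding quotient_poly_def by (intro continuous_intros)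
  ultimately obtain r where "?l \<le> r" "r \<le> n - 1" "quotient_poly n K d r = 0"
    using IVT'[of "quotient_poly n K d" ?l 0 "n - 1"] lo hi by blast
  then show thesis using that by blast
qed

text \<open>At a common \<open>r\<close> the difference of the polynomials for \<open>s\<close> and
  \<open>d\<close> is K (s - d) times an explicit cofactor. Since r \<le> n - 1, it suffices that m
  (s^2 + s d + d^2) < r^2 with m = K + 1.\<close>

lemma quotient_poly_pos:
  fixes n K d s r :: real
  assumes "K \<ge> 2" "d \<ge> 1" and n: "n \<ge> 3 * (K + 1) * d + 2" and sd: "s > d" and sn: "(K + 1) * s \<le> n"
    and root: "quotient_poly n K d r = 0" and r: "r \<ge> n - K * d - 1" "r \<le> n - 1"
  shows "quotient_poly n K s r > 0"
proof -
  define m where "m = K + 1"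
  have m: "m \<ge> 3" using assms m_def by simp
  let ?Q = "r * (r + 1) + (s + d) * (n - 1 - r) - m * (s\<^sup>2 + s * d + d\<^sup>2)"
  have diff: "quotient_poly n K s r - quotient_poly n K d r = K * (s - d) * ?Q"
    unfolding quotient_poly_def m_def by (simp add: algebra_simps power2_eq_square)
  have md: "3 * (m * d) \<le> n - 2" using n unfolding m_def by (simp add: algebra_simps)
  have ms: "m * s \<le> n" using sn unfolding m_def .
  have mm: "m \<le> m * d" using m assms by simp
  have n11: "n \<ge> 11" using md mm m by linarith
  have md0: "0 \<le> m * d" "0 \<le> m * s" using m assms by auto
  have mdn: "m * d \<le> n / 3" using md by simp
  have "m * s * (m * s) \<le> n * n" using ms md0 n11 by (intro mult_mono) auto
  moreover have "m * s * (m * d) \<le> n * (n / 3)" using ms mdn md0 n11 by (intro mult_mono) auto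
  moreover have "m * d * (m * d) \<le> n / 3 * (n / 3)" using mdn md0 n11 by (intro mult_mono) auto
  \<comment> \<open>13/9 = 1 + 1/3 + 1/9, from m s \<le> n and m d \<le> n / 3.\<close>
  ultimately have sum: "m * (m * (s\<^sup>2 + s * d + d\<^sup>2)) \<le> 13 / 9 * n\<^sup>2"
    by (simp add: algebra_simps power2_eq_square)
  have "(m - 1) * (3 * (m * d)) \<le> (m - 1) * (n - 2)" using md m by (intro mult_left_mono) auto
  moreover have "3 * m * (n - K * d - 1) \<le> 3 * m * r" using r m by (intro mult_left_mono) auto
  ultimately have "(2 * m + 1) * n - m - 2 \<le> 3 * m * r"
    unfolding m_def by (simp add: algebra_simps)
  moreover have "m + 2 \<le> n / 2" using mm md n11 by linarith
  ultimately have mr: "(2 * m + 1 / 2) * n \<le> 3 * m * r" by (simp add: algebra_simps)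
  have mn0: "0 \<le> (2 * m + 1 / 2) * n" using m n11 by simp
  have "(2 * m + 1 / 2) * n * ((2 * m + 1 / 2) * n) \<le> 3 * m * r * (3 * m * r)"
    using mn0 mr by (intro mult_mono mr order_trans[OF mn0 mr])
  then have "(4 * m\<^sup>2 + 2 * m + 1 / 4) * n\<^sup>2 \<le> 9 * m\<^sup>2 * r\<^sup>2"
    by (simp add: algebra_simps power2_eq_square)
  \<comment> \<open>The cruder bound r \<ge> 2 n / 3 would leave only the term in m^2, which is too
    small at m = 3, that is, for k = 1; hence the extra 1/2 in \<open>mr\<close>.\<close>
  moreover have "13 * m < 4 * m\<^sup>2 + 2 * m + 1 / 4"
  proof -
    have "3 * m \<le> m * m" using m by (intro mult_right_mono) auto
    then show ?thesis using m unfolding power2_eq_square by linarith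
  qed
  then have "13 * m * n\<^sup>2 < (4 * m\<^sup>2 + 2 * m + 1 / 4) * n\<^sup>2"
    using n11 by (intro mult_strict_right_mono) auto
  moreover have "9 * m * (m * (m * (s\<^sup>2 + s * d + d\<^sup>2))) \<le> 9 * m * (13 / 9 * n\<^sup>2)"
    using sum m by (intro mult_left_mono) auto
  ultimately have "9 * m * (m * (m * (s\<^sup>2 + s * d + d\<^sup>2))) < 9 * m\<^sup>2 * r\<^sup>2" by simp
  then have "9 * m\<^sup>2 * (m * (s\<^sup>2 + s * d + d\<^sup>2)) < 9 * m\<^sup>2 * r\<^sup>2"
    by (simp add: power2_eq_square mult.assoc)
  then have "m * (s\<^sup>2 + s * d + d\<^sup>2) < r\<^sup>2" using m by simp
  moreover have "0 \<le> 3 * m * r" using mn0 mr by linarith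
  then have "r \<ge> 0" using m by (simp add: zero_le_mult_iff)
  moreover have "(s + d) * (n - 1 - r) \<ge> 0" using assms by (intro mult_nonneg_nonneg) auto
  ultimately have "?Q > 0" by (simp add: power2_eq_square algebra_simps)
  then have "K * (s - d) * ?Q > 0" using assms by simp
  then show ?thesis using diff root by simp
qed

section \<open>The extremal shape and its spectral radius\<close>

text \<open>One description with named parts serves both the concrete graph on natural numbers and
  the shape finally forced on \<open>G\<close>.\<close>

definition complete_split :: "'a set \<Rightarrow> 'a set set \<Rightarrow> 'a set \<Rightarrow> 'a set \<Rightarrow> 'a set \<Rightarrow> bool" where
  "complete_split V E S I B \<longleftrightarrow> finite V \<and> V = S \<union> I \<union> B \<and>
     S \<inter> I = {} \<and> S \<inter> B = {} \<and> I \<inter> B = {} \<and>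
     (\<forall>u\<in>V. \<forall>v\<in>V. adj E u v \<longleftrightarrow> u \<noteq> v \<and> (u \<in> S \<or> v \<in> S \<or> (u \<in> B \<and> v \<in> B)))"

lemma complete_split_nbs:
  assumes "complete_split V E S I B"
  shows "v \<in> S \<Longrightarrow> nbs V E v = S \<union> I \<union> B - {v}"
    and "v \<in> I \<Longrightarrow> nbs V E v = S"
    and "v \<in> B \<Longrightarrow> nbs V E v = S \<union> B - {v}"
  using assms unfolding complete_split_def nbs_def by blast+

lemma complete_splitI_nbs:
  assumes "finite V" "V = S \<union> I \<union> B" "S \<inter> I = {}" "S \<inter> B = {}" "I \<inter> B = {}"
    and "\<And>v. v \<in> S \<Longrightarrow> nbs V E v = S \<union> I \<union> B - {v}"
    and "\<And>v. v \<in> I \<Longrightarrow> nbs V E v = S"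
    and "\<And>v. v \<in> B \<Longrightarrow> nbs V E v = S \<union> B - {v}"
  shows "complete_split V E S I B"
proof -
  have "adj E u v \<longleftrightarrow> u \<noteq> v \<and> (u \<in> S \<or> v \<in> S \<or> (u \<in> B \<and> v \<in> B))" if uv: "u \<in> V" "v \<in> V" for u v
  proof -
    have *: "adj E u v \<longleftrightarrow> v \<in> nbs V E u" using uv by (simp add: nbs_def)
    consider "u \<in> S" | "u \<in> I" | "u \<in> B" using uv assms(2) by blast
    then show ?thesis unfolding * using uv assms(2-8) by cases auto
  qed
  then show ?thesis using assms(1-5) unfolding complete_split_def by blast
qed

lemma complete_split_iso:
  assumes G: "complete_split V E S I B" and G': "complete_split V' E' S' I' B'"
    and c: "card S = card S'" "card I = card I'" "card B = card B'"
  shows "graph_iso V E V' E'"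
proof -
  have V: "V = S \<union> I \<union> B" "S \<inter> I = {}" "S \<inter> B = {}" "I \<inter> B = {}" "finite V"
    and V': "V' = S' \<union> I' \<union> B'" "S' \<inter> I' = {}" "S' \<inter> B' = {}" "I' \<inter> B' = {}" "finite V'"
    using G G' unfolding complete_split_def by auto
  obtain f1 where f1: "bij_betw f1 S S'"
    using finite_same_card_bij[of S S'] V V' c by (metis finite_Un)
  obtain f2 where f2: "bij_betw f2 I I'"
    using finite_same_card_bij[of I I'] V V' c by (metis finite_Un)
  obtain f3 where f3: "bij_betw f3 B B'"
    using finite_same_card_bij[of B B'] V V' c by (metis finite_Un)
  define f where "f v = (if v \<in> S then f1 v else if v \<in> I then f2 v else f3 v)" for v
  have fS: "bij_betw f S S'" using f1 by (rule bij_betw_cong[THEN iffD1, rotated]) (simp add: f_def)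
  have fI: "bij_betw f I I'" using f2 by (rule bij_betw_cong[THEN iffD1, rotated]) (use V in \<open>auto simp: f_def\<close>)
  have fB: "bij_betw f B B'" using f3 by (rule bij_betw_cong[THEN iffD1, rotated]) (use V in \<open>auto simp: f_def\<close>)
  have "bij_betw f (S \<union> I) (S' \<union> I')" using fS fI V'(2) by (rule bij_betw_combine)
  then have bij: "bij_betw f V V'"
    unfolding V(1) V'(1) using fB by (rule bij_betw_combine) (use V' in blast)
  have mem: "f v \<in> V'" "f v \<in> S' \<longleftrightarrow> v \<in> S" "f v \<in> B' \<longleftrightarrow> v \<in> B" if "v \<in> V" for v
  proof -
    have "v \<in> S \<Longrightarrow> f v \<in> S'" "v \<in> I \<Longrightarrow> f v \<in> I'" "v \<in> B \<Longrightarrow> f v \<in> B'"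
      using fS fI fB bij_betwE by blast+
    moreover have "v \<in> S \<or> v \<in> I \<or> v \<in> B" using that V(1) by blast
    ultimately show "f v \<in> V'" "f v \<in> S' \<longleftrightarrow> v \<in> S" "f v \<in> B' \<longleftrightarrow> v \<in> B"
      using V(2-4) V'(1-4) by blast+
  qed
  have "adj E u v \<longleftrightarrow> adj E' (f u) (f v)" if u: "u \<in> V" and v: "v \<in> V" for u v
  proof -
    have "f u = f v \<longleftrightarrow> u = v" using inj_on_eq_iff[OF bij_betw_imp_inj_on[OF bij] u v] .
    moreover have "adj E u v \<longleftrightarrow> u \<noteq> v \<and> (u \<in> S \<or> v \<in> S \<or> (u \<in> B \<and> v \<in> B))"
      using G u v unfolding complete_split_def by simp
    moreover have "adj E' (f u) (f v) \<longleftrightarrow> f u \<noteq> f v \<and> (f u \<in> S' \<or> f v \<in> S' \<or> (f u \<in> B' \<and> f v \<in> B'))"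
      using G' mem(1)[OF u] mem(1)[OF v] unfolding complete_split_def by simp
    ultimately show ?thesis using mem[OF u] mem[OF v] by simp
  qed
  then show ?thesis unfolding graph_iso_def using bij by blast
qed

lemma adj_join_K_union_K_I:
  "adj (join_K_union_K_I_edges a b c) u v \<longleftrightarrow> u < a + b + c \<and> v < a + b + c \<and> u \<noteq> v \<and>
     (u < a \<or> v < a \<or> (u \<in> {a..<a + b} \<and> v \<in> {a..<a + b}))"
  (is "?l \<longleftrightarrow> ?r")
proof
  assume ?l
  then obtain u' v' where "{u, v} = {u', v'}" "u' < a + b + c" "v' < a + b + c" "u' \<noteq> v'"
    "u' < a \<or> v' < a \<or> (u' \<in> {a..<a + b} \<and> v' \<in> {a..<a + b})"
    unfolding adj_def join_K_union_K_I_edges_def by auto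
  then show ?r by (auto simp: doubleton_eq_iff)
next
  assume ?r
  then show ?l unfolding adj_def join_K_union_K_I_edges_def mem_Collect_eq
    by (intro exI[of _ u] exI[of _ v]) auto
qed

lemma complete_split_join:
  "complete_split (join_K_union_K_I_verts a b c) (join_K_union_K_I_edges a b c)
     {0..<a} {a + b..<a + b + c} {a..<a + b}"
  unfolding complete_split_def join_K_union_K_I_verts_def adj_join_K_union_K_I by auto

text \<open>The weights solve the rows of \<open>I\<close> and \<open>B\<close> by construction and
  \<open>root\<close> is the row of \<open>S\<close>, so \<open>r\<close> is an eigenvalue.\<close>

lemma complete_split_spectral_radius_ge:
  fixes r :: real
  assumes G: "complete_split V E S I B" and "S \<noteq> {}"
    and pos: "r > 0" "r + 1 - real (card B) > 0"
    and root: "r = real (card S) - 1 + real (card I) * (real (card S) / r)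
                 + real (card B) * (real (card S) / (r + 1 - real (card B)))"
  shows "r \<le> spectral_radius V E"
proof -
  have V: "V = S \<union> I \<union> B" and disj: "S \<inter> I = {}" "S \<inter> B = {}" "I \<inter> B = {}" and fin: "finite V"
    using G unfolding complete_split_def by auto
  then have fins: "finite S" "finite I" "finite B" by auto
  define x where "x v = (if v \<in> S then 1 else if v \<in> I then real (card S) / r
    else real (card S) / (r + 1 - real (card B)))" for v
  note sums = joined_graph_weight_sums[OF fins disj pos, folded x_def]
  have "(\<Sum>w\<in>nbs V E u. x w) = r * x u" if "u \<in> V" for u
  proof -
    consider "u \<in> S" | "u \<in> I" | "u \<in> B" using \<open>u \<in> V\<close> V by blast
    then show ?thesis
    proof cases
      case 1
      then show ?thesis using sums(1)[of u] complete_split_nbs(1)[OF G 1] root by (simp add: x_def)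
    next
      case 2
      then have "x u = real (card S) / r" using disj by (auto simp: x_def)
      then show ?thesis using sums(2) complete_split_nbs(2)[OF G 2] pos by simp
    next
      case 3
      then have "x u = real (card S) / (r + 1 - real (card B))" using disj by (auto simp: x_def)
      then show ?thesis using sums(3)[OF 3] complete_split_nbs(3)[OF G 3] by simp
    qed
  qed
  then have "\<forall>u\<in>V. (\<Sum>w\<in>nbs V E u. complex_of_real (x w)) = of_real r * of_real (x u)"
    by (simp flip: of_real_mult of_real_sum)
  moreover obtain v where "v \<in> S" using \<open>S \<noteq> {}\<close> by blast
  then have v: "v \<in> V" "complex_of_real (x v) \<noteq> 0" using V by (auto simp: x_def)
  ultimately have "adj_eigenvalue V E (of_real r)"
    unfolding adj_eigenvalue_def adj_sum_eq_nbs_sum[OF fin]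
    by (intro exI[of _ "\<lambda>v. complex_of_real (x v)"]) blast
  from cmod_le_spectral_radius[OF fin _ this] show ?thesis
    using pos v by auto
qed

lemma sum_pos_subset_eq:
  fixes x :: "'a \<Rightarrow> real"
  assumes "finite B" "A \<subseteq> B" "\<And>v. v \<in> B \<Longrightarrow> x v > 0" "sum x A \<ge> sum x B"
  shows "A = B"
proof (rule ccontr)
  assume "A \<noteq> B"
  then obtain b where "b \<in> B - A" using assms(2) by blast
  then have "sum x A < sum x B"
    using assms(1-3) by (intro sum_strict_mono2[of B A b]) (auto intro: less_imp_le)
  then show False using assms(4) by simp
qed

lemma min_degree_pos:
  assumes simple: "simple_graph V E" and conn: "connected_graph V E" and "card V \<ge> 2"
  shows "min_degree V E \<ge> 1"
proof -
  have fin: "finite V" and ne: "V \<noteq> {}" using simple assms(3) by (auto simp: simple_graph_def)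
  then have "min_degree V E \<in> Defs.degree V E ` V" unfolding min_degree_def by (intro Min_in) auto
  then obtain v where v: "v \<in> V" "min_degree V E = card (nbs V E v)"
    by (auto simp: Defs.degree_def nbs_def)
  have "nbs V E v \<noteq> {}"
  proof
    assume "nbs V E v = {}"
    then have "{v} = V"
      using conn v(1) unfolding connected_graph_iff_nbs_closed_conn nbs_closed_conn_def by auto
    then have "card V = card {v}" by simp
    then show False using assms(3) by simp
  qed
  moreover have "finite (nbs V E v)" using fin by (simp add: nbs_def)
  ultimately show ?thesis using v(2) by (simp add: Suc_le_eq card_gt_0_iff)
qed

lemma min_degree_le_card_isolating:
  assumes "finite V" "S \<subseteq> V" "v \<in> isolated V E S"
  shows "min_degree V E \<le> card S"
proof -
  have "min_degree V E \<le> Defs.degree V E v"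
    unfolding min_degree_def using assms by (intro Min_le) (auto simp: isolated_def)
  also have "\<dots> = card (nbs V E v)" by (simp add: Defs.degree_def nbs_def)
  also have "\<dots> \<le> card S"
    using assms by (intro card_mono) (auto simp: isolated_def intro: finite_subset)
  finally show ?thesis .
qed

theorem theorem1p14:
  fixes V :: "'a set" and E :: "'a set set" and k n \<delta> :: nat
  assumes "simple_graph V E"
    and "connected_graph V E"
    and "card V = n"
    and "k \<ge> 1"
    and "min_degree V E = \<delta>"
    and "n \<ge> 3 * (k + 2) * \<delta> + 2"
    and "spectral_radius V E \<ge>
           spectral_radius (join_K_union_K_I_verts \<delta> (n - k * \<delta> - 2 * \<delta>) (k * \<delta> + \<delta>))
                           (join_K_union_K_I_edges \<delta> (n - k * \<delta> - 2 * \<delta>) (k * \<delta> + \<delta>))"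
  shows "(\<exists>T. spanning_tree V E T \<and> leaf_degree V T \<le> k) \<or>
         graph_iso V E (join_K_union_K_I_verts \<delta> (n - k * \<delta> - 2 * \<delta>) (k * \<delta> + \<delta>))
                       (join_K_union_K_I_edges \<delta> (n - k * \<delta> - 2 * \<delta>) (k * \<delta> + \<delta>))"
proof (cases "\<exists>T. spanning_tree V E T \<and> leaf_degree V T \<le> k")
  case False
  let ?b\<delta> = "n - k * \<delta> - 2 * \<delta>" and ?c\<delta> = "k * \<delta> + \<delta>"
  let ?V\<delta> = "join_K_union_K_I_verts \<delta> ?b\<delta> ?c\<delta>" and ?E\<delta> = "join_K_union_K_I_edges \<delta> ?b\<delta> ?c\<delta>"
  have fin: "finite V" using assms(1) by (simp add: simple_graph_def)
  have \<delta>1: "\<delta> \<ge> 1" using min_degree_pos[OF assms(1,2)] assms(3,5,6) by simp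
  have "3 * (1 + 2) * 1 \<le> 3 * (k + 2) * \<delta>" using assms(4) \<delta>1 by (intro mult_le_mono) auto
  then have "card V \<ge> 4" and ne: "V \<noteq> {}" using assms(3,6) by auto
  then obtain S where S: "S \<subseteq> V" "S \<noteq> {}" "(k + 1) * card S \<le> card (isolated V E S)"
    using kaneko_spanning_tree[OF assms(1,2) _ assms(4)] False by (meson not_le)
  define s where "s = card S"
  have finS: "finite S" using fin S(1) by (rule rev_finite_subset)
  have s0: "s > 0" using S(2) finS by (simp add: s_def card_gt_0_iff)
  \<comment> \<open>Exactly (k + 1) s isolated vertices are kept. Any others go to \<open>B\<close>,
    which is harmless since neighbourhoods are only bounded from above.\<close>
  obtain I where I: "I \<subseteq> isolated V E S" "card I = (k + 1) * s"
    using obtain_subset_with_card_n[OF S(3)] unfolding s_def by blast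
  have finI: "finite I" using I(1) fin by (auto simp: isolated_def intro: finite_subset)
  have IV: "I \<subseteq> V" "S \<inter> I = {}" and IN: "\<And>v. v \<in> I \<Longrightarrow> nbs V E v \<subseteq> S"
    using I(1) by (auto simp: isolated_def)
  define B where "B = V - S - I"
  have finB: "finite B" using fin by (simp add: B_def)
  have VU: "V = S \<union> I \<union> B" and disj: "S \<inter> B = {}" "I \<inter> B = {}"
    using S(1) IV unfolding B_def by auto
  have "card V = card S + card I + card B"
    unfolding VU using finS finI finB IV(2) disj
    by (simp add: card_Un_disjoint Int_Un_distrib2)
  then have n_eq: "n = (k + 2) * s + card B" using I(2) assms(3) by (simp add: s_def algebra_simps)
  have "card I > 0" using I(2) s0 by simp
  then obtain v0 where "v0 \<in> I" by fastforce
  then have \<delta>s: "\<delta> \<le> s"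
    using min_degree_le_card_isolating[OF fin S(1)] I(1) assms(5) unfolding s_def by blast

  define K where "K = real k + 1"
  have K: "K \<ge> 2" using assms(4) by (simp add: K_def)
  have "real (3 * (k + 2) * \<delta> + 2) \<le> real n" using assms(6) by (rule of_nat_mono)
  then have nr: "real n \<ge> 3 * (K + 1) * real \<delta> + 2" unfolding K_def by (simp add: algebra_simps)
  have cardB: "real (card B) = real n - (K + 1) * real s"
    unfolding n_eq K_def by (simp add: algebra_simps)
  have cardI: "real (card I) = K * real s" unfolding I(2) K_def by (simp add: algebra_simps)
  have "n \<ge> 3 * ((k + 2) * \<delta>) + 2" using assms(6) by (simp only: mult.assoc)
  then have "(k + 2) * \<delta> \<le> n" by linarith
  then have "k * \<delta> + 2 * \<delta> \<le> n" by (simp add: algebra_simps)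
  then have b\<delta>: "real ?b\<delta> = real n - (K + 1) * real \<delta>" unfolding K_def
    by (simp add: of_nat_diff algebra_simps)
  have c\<delta>: "real ?c\<delta> = K * real \<delta>" unfolding K_def by (simp add: algebra_simps)
  obtain r where root: "quotient_poly (real n) K (real \<delta>) r = 0"
    and r: "r \<ge> real n - K * real \<delta> - 1" "r \<le> real n - 1"
    using quotient_poly_root[OF K _ nr] \<delta>1 by auto
  have "2 * 1 \<le> K * real \<delta>" using K \<delta>1 by (intro mult_mono) auto
  then have r0: "r > 0" using r(1) nr \<delta>1 by (simp add: algebra_simps)
  \<comment> \<open>Positivity of the denominator of the weight on \<open>B\<close>, for the
    extremal graph with t = \<delta> and for \<open>G\<close> with t = s.\<close>
  have gap: "r + 1 - (real n - (K + 1) * t) > 0" if "t \<ge> real \<delta>" for t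
  proof -
    have "K * real \<delta> \<le> K * t" using that K by (intro mult_left_mono) auto
    then show ?thesis using r(1) that \<delta>1 by (simp add: algebra_simps)
  qed
  have "r = real \<delta> - 1 + K * real \<delta> * (real \<delta> / r) + real ?b\<delta> * (real \<delta> / (r + 1 - real ?b\<delta>))"
    using quotient_row[OF b\<delta> r0] gap[of "real \<delta>"] root unfolding b\<delta> by simp
  then have "r \<le> spectral_radius ?V\<delta> ?E\<delta>"
    using complete_split_spectral_radius_ge[OF complete_split_join, of \<delta> r ?b\<delta> ?c\<delta>]
      \<delta>1 r0 gap[of "real \<delta>"] c\<delta> b\<delta> by simp
  then have r_le: "r \<le> spectral_radius V E" using assms(7) by linarith

  have pos: "r + 1 - real (card B) > 0" unfolding cardB using gap \<delta>s by simp
  define x where "x v = (if v \<in> S then 1 else if v \<in> I then real (card S) / r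
    else real (card S) / (r + 1 - real (card B)))" for v
  note sums = joined_graph_weight_sums[OF finS finI finB IV(2) disj r0 pos, folded x_def s_def VU]
  have xpos: "x v > 0" for v using s0 r0 pos by (simp add: x_def s_def)
  have xI: "x v = real s / r" if "v \<in> I" for v using that IV(2) by (auto simp: x_def s_def)
  have xB: "x v = real s / (r + 1 - real (card B))" if "v \<in> B" for v
    using that disj by (auto simp: x_def s_def)
  have row: "sum x (V - {v}) = r - quotient_poly (real n) K (real s) r / (r * (r + 1 - real (card B)))"
    if "v \<in> S" for v
    using sums(1)[OF that] quotient_row[OF cardB r0 pos] unfolding cardI by linarith
  have P0: "quotient_poly (real n) K (real s) r \<ge> 0"
    and Ps: "\<delta> < s \<Longrightarrow> quotient_poly (real n) K (real s) r > 0"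
  proof -
    show *: "quotient_poly (real n) K (real s) r > 0" if "\<delta> < s"
      using quotient_poly_pos[OF K _ nr _ _ root r, of "real s"] \<delta>1 that cardB by simp
    show "quotient_poly (real n) K (real s) r \<ge> 0"
      using * root \<delta>s by (cases "\<delta> < s") auto
  qed
  have nbs_ne: "nbs V E v \<subseteq> V - {v}" for v
    using simple_graph_adjD[OF assms(1)] unfolding nbs_def by blast
  have nbs_B: "nbs V E v \<subseteq> S \<union> B - {v}" if "v \<in> B" for v
  proof
    fix u assume u: "u \<in> nbs V E v"
    have "v \<in> nbs V E u" using u that VU adj_sym[of E] unfolding nbs_def by blast
    then have "u \<notin> I" using IN disj that by blast
    then show "u \<in> S \<union> B - {v}" using u nbs_ne[of v] VU by blast
  qed
  \<comment> \<open>The neighbourhood of \<open>v\<close> in the three-part graph that contains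
    \<open>G\<close>.\<close>
  define M where "M v = (if v \<in> S then V - {v} else if v \<in> I then S else S \<union> B - {v})" for v
  have M_S: "M v = V - {v}" if "v \<in> S" for v using that by (simp add: M_def)
  have M_I: "M v = S" if "v \<in> I" for v using that IV(2) by (auto simp: M_def)
  have M_B: "M v = S \<union> B - {v}" if "v \<in> B" for v using that disj by (auto simp: M_def)
  have finM: "finite (M v)" for v unfolding M_def using fin finS finB by simp
  have nbs_M: "nbs V E v \<subseteq> M v" if "v \<in> V" for v
    using that VU M_S[of v] M_I[of v] M_B[of v] nbs_ne[of v] IN[of v] nbs_B[of v] by auto
  have M_row: "sum x (M v) \<le> r * x v" if v: "v \<in> V" for v
  proof -
    consider "v \<in> S" | "v \<in> I" | "v \<in> B" using v VU by blast
    then show ?thesis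
    proof cases
      case 1
      have "quotient_poly (real n) K (real s) r / (r * (r + 1 - real (card B))) \<ge> 0"
        using P0 r0 pos by simp
      then show ?thesis using 1 M_S row by (simp add: x_def)
    next
      case 2
      then show ?thesis using M_I xI sums(2) r0 by simp
    next
      case 3
      then show ?thesis using M_B xB sums(3) by simp
    qed
  qed
  have nbs_le: "sum x (nbs V E v) \<le> sum x (M v)" if "v \<in> V" for v
    using finM nbs_M[OF that] xpos by (intro sum_mono2) (auto intro: less_imp_le)
  obtain \<mu> where \<mu>: "adj_eigenvalue V E \<mu>" "cmod \<mu> = spectral_radius V E"
    using spectral_radius_attained[OF fin ne] by blast
  have eq: "sum x (nbs V E v) = r * x v" if "v \<in> V" for v
    using order_trans[OF nbs_le M_row] xpos \<mu> r_le that
    by (intro supersolution_eq_if_large_eigenvalue[OF assms(1,2)]) auto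
  \<comment> \<open>Equality in the supersolution, with positive weights, leaves no room for a
    missing edge.\<close>
  have nbs_eq: "nbs V E v = M v" if "v \<in> V" for v
    using finM nbs_M[OF that] xpos eq[OF that] M_row[OF that]
    by (intro sum_pos_subset_eq[of "M v" "nbs V E v" x]) auto
  have "s = \<delta>"
  proof (rule ccontr)
    assume "s \<noteq> \<delta>"
    then have "quotient_poly (real n) K (real s) r / (r * (r + 1 - real (card B))) > 0"
      using Ps \<delta>s r0 pos by simp
    moreover obtain v where v: "v \<in> S" using S(2) by blast
    ultimately have "sum x (M v) < r * x v" using M_S[OF v] row[OF v] by (simp add: x_def)
    then show False using eq[of v] nbs_eq[of v] v S(1) by (metis less_irrefl subsetD)
  qed
  have "complete_split V E S I B"
    using VU nbs_eq M_S M_I M_B by (intro complete_splitI_nbs[OF fin VU IV(2) disj]) auto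
  moreover have "card S = \<delta>" "card I = ?c\<delta>" "card B = ?b\<delta>"
    using \<open>s = \<delta>\<close> I(2) n_eq by (simp_all add: s_def algebra_simps)
  ultimately have "graph_iso V E ?V\<delta> ?E\<delta>"
    by (intro complete_split_iso[OF _ complete_split_join]) auto
  then show ?thesis by blast
qed blast

end
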